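(* Let $I\subset\mathbb{R}$ be a bounded interval, $\mathcal{H}=L^2(I)$, and let $J:L^2(I)\to[0,+\infty]$ be the one-dimensional total variation on $I$, i.e. $J(u)=|Du|(I)$ for $u\in L^2(I)\cap BV(I)$ and $J(u)=+\infty$ otherwise. Then the gradient flow $\partial_tu(t)=-p(t)$, $p(t)\in\partial J(u(t))$ with $u(0)=f$ yields a sequence of eigenvectors $p(t)$ for $t>0$, i.e. $p(t)\in\partial J(p(t))$ for all $t>0$.
   Context: The subdifferential is $\partial J(u)=\{p\in\mathcal{H}:\langle p,v\rangle\le J(v)\ \forall v\in\mathcal{H},\ \langle p,u\rangle=J(u)\}$, with $\langle\cdot,\cdot\rangle$ the $L^2(I)$ inner product, and $\mathrm{dom}(\partial J)=\{u:\partial J(u)\ne\emptyset\}$. The total variation $|Du|(I)$ is taken over the interior of $I$. Gradient flow: for $f\in\overline{\mathrm{dom}(\partial J)}$, the solution $(u,p)$ of $\partial_tu(t)=-p(t)$, $p(t)\in\partial J(u(t))$, $u(0)=f$ is the unique continuous $u:[0,\infty)\to\mathcal{H}$ with $u(0)=f$ given by Brezis' theory (Lipschitz on $[\delta,\infty)$ for every $\delta>0$, $u(t)\in\mathrm{dom}(\partial J)$ for all $t>0$, right-differentiable at every $t>0$), together with $p(t):=-\partial_t^+u(t)$, which is the element of minimal norm in $\partial J(u(t))$ for every $t>0$. *)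

theory Defs
  imports "HOL-Analysis.Analysis"
begin

text \<open>
  Elements of \<open>L\<^sup>2(I)\<close> are represented by square-integrable functions, i.e. by
  representatives of their a.e.-classes; values outside \<open>I\<close> are irrelevant. Equality in
  \<open>L\<^sup>2(I)\<close> is equality a.e. on \<open>I\<close>, and everything below depends only on the
  a.e.-classes of the functions involved.
\<close>

definition L2 :: "real set \<Rightarrow> (real \<Rightarrow> real) set" where
  "L2 I = {u \<in> borel_measurable (lebesgue_on I). integrable (lebesgue_on I) (\<lambda>x. (u x)\<^sup>2)}"

definition l2_inner :: "real set \<Rightarrow> (real \<Rightarrow> real) \<Rightarrow> (real \<Rightarrow> real) \<Rightarrow> real" where
  "l2_inner I u v = (LINT x|lebesgue_on I. u x * v x)"

definition l2_norm :: "real set \<Rightarrow> (real \<Rightarrow> real) \<Rightarrow> real" where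
  "l2_norm I u = sqrt (l2_inner I u u)"

definition l2_closure :: "real set \<Rightarrow> (real \<Rightarrow> real) set \<Rightarrow> (real \<Rightarrow> real) set" where
  "l2_closure I S = {f \<in> L2 I. \<forall>e>0. \<exists>g\<in>S. l2_norm I (\<lambda>x. f x - g x) < e}"

text \<open>The space \<open>C\<^sub>c\<^sup>1(U)\<close>, its members being extended by zero to the whole line.\<close>

definition C1_compact_support :: "real set \<Rightarrow> (real \<Rightarrow> real) set" where
  "C1_compact_support U =
     {\<phi>. \<phi> C1_differentiable_on UNIV \<and>
         compact (closure {x. \<phi> x \<noteq> 0}) \<and> closure {x. \<phi> x \<noteq> 0} \<subseteq> U}"

text \<open>The variation \<open>|Du|(U)\<close> of an integrable function on an open set \<open>U\<close>, and \<open>BV(U)\<close>.\<close>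

definition total_variation :: "real set \<Rightarrow> (real \<Rightarrow> real) \<Rightarrow> ereal" where
  "total_variation U u =
     (SUP \<phi>\<in>{\<phi> \<in> C1_compact_support U. \<forall>x. \<bar>\<phi> x\<bar> \<le> 1}.
        ereal (LINT x|lebesgue_on U. u x * deriv \<phi> x))"

definition BV :: "real set \<Rightarrow> (real \<Rightarrow> real) set" where
  "BV U = {u. integrable (lebesgue_on U) u \<and> total_variation U u < \<infinity>}"

definition TV :: "real set \<Rightarrow> (real \<Rightarrow> real) \<Rightarrow> ereal" where
  "TV I u = (if u \<in> L2 I \<inter> BV (interior I) then total_variation (interior I) u else \<infinity>)"

definition subdiff ::
  "real set \<Rightarrow> ((real \<Rightarrow> real) \<Rightarrow> ereal) \<Rightarrow> (real \<Rightarrow> real) \<Rightarrow> (real \<Rightarrow> real) set" where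
  "subdiff I J u =
     {p \<in> L2 I. (\<forall>v\<in>L2 I. ereal (l2_inner I p v) \<le> J v) \<and> ereal (l2_inner I p u) = J u}"

definition dom_subdiff :: "real set \<Rightarrow> ((real \<Rightarrow> real) \<Rightarrow> ereal) \<Rightarrow> (real \<Rightarrow> real) set" where
  "dom_subdiff I J = {u \<in> L2 I. subdiff I J u \<noteq> {}}"

text \<open>
  \<open>(u, p)\<close> solves \<open>\<partial>\<^sub>t u(t) = - p(t)\<close>, \<open>p(t) \<in> \<partial>J(u(t))\<close>, \<open>u(0) = f\<close>, where
  \<open>- p(t)\<close> is the right derivative of \<open>u\<close> at \<open>t > 0\<close> with respect to the \<open>L\<^sup>2(I)\<close> norm.
  That \<open>p(t)\<close> is the element of minimal norm of \<open>\<partial>J(u(t))\<close> is a consequence of these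
  conditions and the monotonicity of \<open>\<partial>J\<close>, so it is not imposed.
\<close>

definition gradient_flow ::
  "real set \<Rightarrow> ((real \<Rightarrow> real) \<Rightarrow> ereal) \<Rightarrow> (real \<Rightarrow> real) \<Rightarrow>
     (real \<Rightarrow> real \<Rightarrow> real) \<Rightarrow> (real \<Rightarrow> real \<Rightarrow> real) \<Rightarrow> bool" where
  "gradient_flow I J f u p \<longleftrightarrow>
     (\<forall>t\<ge>0. u t \<in> L2 I) \<and>
     (AE x in lebesgue_on I. u 0 x = f x) \<and>
     (\<forall>t\<ge>0. ((\<lambda>s. l2_norm I (\<lambda>x. u s x - u t x)) \<longlongrightarrow> 0) (at t within {0..})) \<and>
     (\<forall>\<delta>>0. \<exists>L. \<forall>s\<ge>\<delta>. \<forall>t\<ge>\<delta>. l2_norm I (\<lambda>x. u s x - u t x) \<le> L * \<bar>s - t\<bar>) \<and>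
     (\<forall>t>0. u t \<in> dom_subdiff I J) \<and>
     (\<forall>t>0. p t \<in> L2 I \<and>
        ((\<lambda>h. l2_norm I (\<lambda>x. (u (t + h) x - u t x) / h - (- p t x))) \<longlongrightarrow> 0) (at_right 0)) \<and>
     (\<forall>t>0. p t \<in> subdiff I J (u t))"

end

theory Submission
  imports Defs
begin

text \<open>
  Write \<open>\<langle>\<cdot>,\<cdot>\<rangle>\<close> and \<open>\<parallel>\<cdot>\<parallel>\<close> for the inner product and norm of \<open>L\<^sup>2(I)\<close>, and \<open>J\<close> for the total
  variation. As \<open>p(t) \<in> \<partial>J(u(t))\<close> gives \<open>\<langle>p(t), v\<rangle> \<le> J(v)\<close> for every \<open>v\<close>, the eigenvector property
  amounts to the single inequality \<open>J(p(t)) \<le> \<parallel>p(t)\<parallel>\<^sup>2\<close>.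

  The flow enters only through minimality: \<open>\<langle>q, p(t)\<rangle> \<ge> \<parallel>p(t)\<parallel>\<^sup>2\<close> for all \<open>q \<in> \<partial>J(u(t))\<close>
  (\<open>gradient_flow_variational\<close>). Monotonicity of \<open>\<partial>J\<close> bounds the right derivative of
  \<open>\<parallel>u(s) - u(t)\<parallel>\<^sup>2 / 2\<close> by \<open>-\<langle>q, u(s) - u(t)\<rangle>\<close>, which is \<open>(s - t) (\<langle>q, p(t)\<rangle> + o(1))\<close>;
  integrating and dividing by \<open>(s - t)\<^sup>2 / 2\<close> gives the claim as \<open>s\<close> decreases to \<open>t\<close>.

  The rest concerns one fixed \<open>p \<in> \<partial>J(u)\<close> with this property, on an open interval \<open>(a,b)\<close>. In one
  dimension \<open>p\<close> has a potential \<open>Z(x) = \<integral>\<^sub>a\<^sup>x p\<close>, and testing \<open>\<langle>p, v\<rangle> \<le> J(v)\<close> with step functions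
  shows \<open>Z(b) = 0\<close> and \<open>|Z| \<le> 1\<close>. Conversely every \<open>w\<close> in \<open>H\<^sup>1\<^sub>0(a,b)\<close> with \<open>|w| \<le> 1\<close> satisfies
  \<open>\<langle>w', v\<rangle> \<le> J(v)\<close> (\<open>H10_deriv_le_TV\<close>). Hence, if \<open>|Z + s \<psi>| \<le> 1\<close> for small \<open>s\<close> of both signs, then
  \<open>p + s \<psi>'\<close> lies in \<open>\<partial>J(u)\<close>, because \<open>s \<langle>\<psi>', u\<rangle> \<le> 0\<close> for both signs, and minimality yields
  \<open>\<langle>\<psi>', p\<rangle> = 0\<close> (\<open>subdiff_minimal_Euler_Lagrange\<close>). Geometrically \<open>Z\<close> is affine where
  \<open>|Z| < 1\<close>. Perturbations must vanish on the contact set \<open>{|Z| = 1}\<close>, and the polynomial cutoffs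
  \<open>\<psi> = \<eta> (1 - Z\<^sup>m)\<close> with even \<open>m\<close> and \<open>|\<eta>| \<le> 1\<close> do so without a description of that set. They give
  \<open>\<langle>p, \<eta>'\<rangle> = \<integral> \<eta>' p Z\<^sup>m + m \<integral> \<eta> Z\<^bsup>m-1\<^esup> p\<^sup>2\<close>.
  For \<open>\<eta> = Z\<close> this reads \<open>\<integral> Z\<^sup>m p\<^sup>2 = \<parallel>p\<parallel>\<^sup>2 / (m + 1)\<close>. For a test function \<open>\<eta> = \<phi>\<close> of the total variation
  the first term is then at most \<open>\<parallel>\<phi>'\<parallel> \<parallel>p\<parallel> / sqrt (2 m + 1)\<close> and the second at most
  \<open>m / (m - 1) \<parallel>p\<parallel>\<^sup>2\<close>. Letting \<open>m\<close> tend to infinity, \<open>\<langle>p, \<phi>'\<rangle> \<le> \<parallel>p\<parallel>\<^sup>2\<close>, and the supremum over \<open>\<phi>\<close> is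
  the desired inequality.
\<close>

section \<open>The pre-Hilbert space of square-integrable functions\<close>

lemma L2_borel [dest]: "u \<in> L2 I \<Longrightarrow> u \<in> borel_measurable (lebesgue_on I)"
  by (simp add: L2_def)

lemma L2_square: "u \<in> L2 I \<Longrightarrow> integrable (lebesgue_on I) (\<lambda>x. (u x)\<^sup>2)"
  by (simp add: L2_def)

lemma L2_mult_integrable:
  assumes u: "u \<in> L2 I" and v: "v \<in> L2 I"
  shows "integrable (lebesgue_on I) (\<lambda>x. u x * v x)"
proof (rule Bochner_Integration.integrable_bound)
  show "integrable (lebesgue_on I) (\<lambda>x. (u x)\<^sup>2 + (v x)\<^sup>2)"
    using L2_square[OF u] L2_square[OF v] by simp
  show "(\<lambda>x. u x * v x) \<in> borel_measurable (lebesgue_on I)"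
    using L2_borel[OF u] L2_borel[OF v] by simp
  have "\<bar>a * b\<bar> \<le> a\<^sup>2 + b\<^sup>2" for a b :: real
  proof -
    have "0 \<le> (\<bar>a\<bar> - \<bar>b\<bar>)\<^sup>2" by simp
    also have "(\<bar>a\<bar> - \<bar>b\<bar>)\<^sup>2 = a\<^sup>2 + b\<^sup>2 - 2 * \<bar>a * b\<bar>"
      by (simp add: power2_diff abs_mult)
    finally show ?thesis by simp
  qed
  then show "AE x in lebesgue_on I. norm (u x * v x) \<le> norm ((u x)\<^sup>2 + (v x)\<^sup>2)"
    by simp
qed

lemma L2_scale [intro]: "u \<in> L2 I \<Longrightarrow> (\<lambda>x. c * u x) \<in> L2 I"
  by (auto simp: L2_def power_mult_distrib)

lemma L2_add [intro]:
  assumes u: "u \<in> L2 I" and v: "v \<in> L2 I"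
  shows "(\<lambda>x. u x + v x) \<in> L2 I"
  using L2_borel[OF u] L2_borel[OF v] L2_square[OF u] L2_square[OF v] L2_mult_integrable[OF u v]
  by (simp add: L2_def power2_sum mult.assoc)

lemma L2_uminus [intro]: "u \<in> L2 I \<Longrightarrow> (\<lambda>x. - u x) \<in> L2 I"
  by (auto simp: L2_def)

lemma L2_diff [intro]: "u \<in> L2 I \<Longrightarrow> v \<in> L2 I \<Longrightarrow> (\<lambda>x. u x - v x) \<in> L2 I"
  using L2_add[of u I "\<lambda>x. - v x"] by auto

lemma L2_divide [intro]: "u \<in> L2 I \<Longrightarrow> (\<lambda>x. u x / c) \<in> L2 I"
  using L2_scale[of u I "1 / c"] by simp

lemma L2_mult_bounded:
  assumes u: "u \<in> L2 I" and b: "b \<in> borel_measurable (lebesgue_on I)"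
    and le: "\<And>x. x \<in> I \<Longrightarrow> \<bar>b x\<bar> \<le> B"
  shows "(\<lambda>x. u x * b x) \<in> L2 I"
proof -
  have "integrable (lebesgue_on I) (\<lambda>x. (u x * b x)\<^sup>2)"
  proof (rule Bochner_Integration.integrable_bound)
    show "integrable (lebesgue_on I) (\<lambda>x. B\<^sup>2 * (u x)\<^sup>2)"
      using L2_square[OF u] by simp
    show "(\<lambda>x. (u x * b x)\<^sup>2) \<in> borel_measurable (lebesgue_on I)"
      using L2_borel[OF u] b by simp
    have "(b x)\<^sup>2 \<le> B\<^sup>2" if "x \<in> I" for x
      using power_mono[OF le[OF that], of 2] by simp
    then show "AE x in lebesgue_on I. norm ((u x * b x)\<^sup>2) \<le> norm (B\<^sup>2 * (u x)\<^sup>2)"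
      by (intro AE_I2) (simp add: power_mult_distrib mult.commute[of "B\<^sup>2"] mult_left_mono)
  qed
  then show ?thesis using L2_borel[OF u] b by (simp add: L2_def)
qed

lemma l2_inner_commute: "l2_inner I u v = l2_inner I v u"
  by (simp add: l2_inner_def mult.commute)

lemma l2_inner_scale_left: "l2_inner I (\<lambda>x. c * u x) v = c * l2_inner I u v"
  by (simp add: l2_inner_def mult.assoc)

lemma l2_inner_scale_right: "l2_inner I u (\<lambda>x. c * v x) = c * l2_inner I u v"
  by (simp add: l2_inner_def mult.left_commute)

lemma l2_inner_uminus_right: "l2_inner I u (\<lambda>x. - v x) = - l2_inner I u v"
  by (simp add: l2_inner_def)

lemma l2_inner_add_right:
  "u \<in> L2 I \<Longrightarrow> v \<in> L2 I \<Longrightarrow> w \<in> L2 I \<Longrightarrow>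
    l2_inner I u (\<lambda>x. v x + w x) = l2_inner I u v + l2_inner I u w"
  by (simp add: l2_inner_def distrib_left L2_mult_integrable)

lemma l2_inner_add_left:
  "u \<in> L2 I \<Longrightarrow> v \<in> L2 I \<Longrightarrow> w \<in> L2 I \<Longrightarrow>
    l2_inner I (\<lambda>x. v x + w x) u = l2_inner I v u + l2_inner I w u"
  by (simp add: l2_inner_def distrib_right L2_mult_integrable)

lemma l2_inner_diff_right:
  "u \<in> L2 I \<Longrightarrow> v \<in> L2 I \<Longrightarrow> w \<in> L2 I \<Longrightarrow>
    l2_inner I u (\<lambda>x. v x - w x) = l2_inner I u v - l2_inner I u w"
  by (simp add: l2_inner_def right_diff_distrib L2_mult_integrable)

lemma l2_inner_diff_left:
  "u \<in> L2 I \<Longrightarrow> v \<in> L2 I \<Longrightarrow> w \<in> L2 I \<Longrightarrow>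
    l2_inner I (\<lambda>x. v x - w x) u = l2_inner I v u - l2_inner I w u"
  by (simp add: l2_inner_def left_diff_distrib L2_mult_integrable)

lemma l2_inner_square_add_scale:
  "u \<in> L2 I \<Longrightarrow> v \<in> L2 I \<Longrightarrow>
    l2_inner I (\<lambda>x. u x + k * v x) (\<lambda>x. u x + k * v x)
      = l2_inner I u u + 2 * k * l2_inner I u v + k\<^sup>2 * l2_inner I v v"
  by (simp add: l2_inner_add_left l2_inner_add_right L2_add L2_scale l2_inner_scale_left
      l2_inner_scale_right l2_inner_commute[of I v u] power2_eq_square algebra_simps)

lemma l2_inner_self_nonneg: "0 \<le> l2_inner I u u"
  by (simp add: l2_inner_def)

lemma l2_norm_nonneg: "0 \<le> l2_norm I u"
  by (simp add: l2_norm_def l2_inner_self_nonneg)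

lemma l2_norm_square: "(l2_norm I u)\<^sup>2 = l2_inner I u u"
  by (simp add: l2_norm_def l2_inner_self_nonneg)

text \<open>
  The classical discriminant argument: \<open>\<parallel>u - s v\<parallel>\<^sup>2\<close> is a nonnegative quadratic polynomial in \<open>s\<close>.
\<close>

lemma l2_Cauchy_Schwarz:
  assumes u: "u \<in> L2 I" and v: "v \<in> L2 I"
  shows "\<bar>l2_inner I u v\<bar> \<le> l2_norm I u * l2_norm I v"
proof -
  let ?a = "l2_inner I u u" and ?b = "l2_inner I u v" and ?c = "l2_inner I v v"
  have pos: "0 \<le> ?a - 2 * s * ?b + s\<^sup>2 * ?c" for s
  proof -
    have "0 \<le> l2_inner I (\<lambda>x. u x - s * v x) (\<lambda>x. u x - s * v x)"
      by (rule l2_inner_self_nonneg)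
    also have "\<dots> = ?a - 2 * s * ?b + s\<^sup>2 * ?c"
      using u v by (simp add: l2_inner_diff_left l2_inner_diff_right L2_diff L2_scale
          l2_inner_scale_left l2_inner_scale_right l2_inner_commute[of I v u]
          power2_eq_square algebra_simps)
    finally show ?thesis .
  qed
  have "?b\<^sup>2 \<le> ?a * ?c"
  proof (cases "?c = 0")
    case True
    have "?b = 0"
    proof (rule ccontr)
      assume b: "?b \<noteq> 0"
      have "2 * ((?a + 1) / (2 * ?b)) * ?b = ?a + 1" using b by simp
      with pos[of "(?a + 1) / (2 * ?b)"] True show False by simp
    qed
    then show ?thesis by (simp add: True)
  next
    case False
    then have c: "?c > 0" using l2_inner_self_nonneg[of I v] by simp
    have "0 \<le> ?c * (?a - 2 * (?b / ?c) * ?b + (?b / ?c)\<^sup>2 * ?c)"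
      using pos[of "?b / ?c"] c by (intro mult_nonneg_nonneg) simp_all
    also have "\<dots> = ?a * ?c - ?b\<^sup>2"
      using c by (simp add: field_simps power2_eq_square)
    finally show ?thesis by simp
  qed
  then have "sqrt (?b\<^sup>2) \<le> sqrt (?a * ?c)" by (rule real_sqrt_le_mono)
  then show ?thesis by (simp add: l2_norm_def real_sqrt_mult)
qed

lemma l2_norm_triangle:
  assumes u: "u \<in> L2 I" and v: "v \<in> L2 I"
  shows "l2_norm I (\<lambda>x. u x + v x) \<le> l2_norm I u + l2_norm I v"
proof (rule power2_le_imp_le)
  show "(l2_norm I (\<lambda>x. u x + v x))\<^sup>2 \<le> (l2_norm I u + l2_norm I v)\<^sup>2"
    using l2_Cauchy_Schwarz[OF u v] u v
    by (simp add: l2_norm_square power2_sum l2_inner_add_left l2_inner_add_right L2_add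
        l2_inner_commute[of I v u])
  show "0 \<le> l2_norm I u + l2_norm I v" by (simp add: l2_norm_nonneg)
qed

lemma l2_norm_scale: "l2_norm I (\<lambda>x. c * u x) = \<bar>c\<bar> * l2_norm I u"
  by (simp add: l2_norm_def l2_inner_scale_left l2_inner_scale_right real_sqrt_mult flip: mult.assoc)

lemma l2_norm_mult_bounded:
  assumes u: "u \<in> L2 I" and b: "b \<in> borel_measurable (lebesgue_on I)"
    and le: "\<And>x. x \<in> I \<Longrightarrow> \<bar>b x\<bar> \<le> B" and B: "0 \<le> B"
  shows "l2_norm I (\<lambda>x. u x * b x) \<le> B * l2_norm I u"
proof (rule power2_le_imp_le)
  have "l2_inner I (\<lambda>x. u x * b x) (\<lambda>x. u x * b x) \<le> l2_inner I (\<lambda>x. B * u x) (\<lambda>x. B * u x)"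
    unfolding l2_inner_def
  proof (rule integral_mono)
    show "integrable (lebesgue_on I) (\<lambda>x. u x * b x * (u x * b x))"
      using L2_mult_bounded[OF u b le] by (rule L2_mult_integrable[OF _ L2_mult_bounded[OF u b le]])
    show "integrable (lebesgue_on I) (\<lambda>x. B * u x * (B * u x))"
      by (intro L2_mult_integrable L2_scale u)
    fix x assume "x \<in> space (lebesgue_on I)"
    then have "(b x)\<^sup>2 \<le> B\<^sup>2" using power_mono[OF le, of x 2] by simp
    then have "(u x)\<^sup>2 * (b x)\<^sup>2 \<le> (u x)\<^sup>2 * B\<^sup>2" by (rule mult_left_mono) simp
    then show "u x * b x * (u x * b x) \<le> B * u x * (B * u x)"
      by (simp add: power2_eq_square algebra_simps)
  qed
  then show "(l2_norm I (\<lambda>x. u x * b x))\<^sup>2 \<le> (B * l2_norm I u)\<^sup>2"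
    using B unfolding l2_norm_square[symmetric] l2_norm_scale by simp
  show "0 \<le> B * l2_norm I u" using B by (simp add: l2_norm_nonneg)
qed

lemma l2_tendsto_inner:
  assumes v: "v \<in> L2 I" and w: "w \<in> L2 I" and V: "eventually (\<lambda>s. V s \<in> L2 I) F"
    and lim: "((\<lambda>s. l2_norm I (\<lambda>x. V s x - v x)) \<longlongrightarrow> 0) F"
  shows "((\<lambda>s. l2_inner I w (V s)) \<longlongrightarrow> l2_inner I w v) F"
proof -
  have "((\<lambda>s. l2_inner I w (V s) - l2_inner I w v) \<longlongrightarrow> 0) F"
  proof (rule Lim_null_comparison)
    show "eventually (\<lambda>s. norm (l2_inner I w (V s) - l2_inner I w v)
        \<le> l2_norm I w * l2_norm I (\<lambda>x. V s x - v x)) F"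
      using V
    proof eventually_elim
      case (elim s)
      then have "l2_inner I w (V s) - l2_inner I w v = l2_inner I w (\<lambda>x. V s x - v x)"
        using v w by (simp add: l2_inner_diff_right)
      with l2_Cauchy_Schwarz[OF w L2_diff[OF elim v]] show ?case by simp
    qed
    show "((\<lambda>s. l2_norm I w * l2_norm I (\<lambda>x. V s x - v x)) \<longlongrightarrow> 0) F"
      using tendsto_mult[OF tendsto_const lim] by simp
  qed
  then show ?thesis by (simp add: LIM_zero_iff)
qed

lemma l2_tendsto_inner_self:
  assumes v: "v \<in> L2 I" and V: "eventually (\<lambda>s. V s \<in> L2 I) F"
    and lim: "((\<lambda>s. l2_norm I (\<lambda>x. V s x - v x)) \<longlongrightarrow> 0) F"
  shows "((\<lambda>s. l2_inner I (V s) (V s)) \<longlongrightarrow> l2_inner I v v) F"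
proof -
  have "((\<lambda>s. (l2_norm I (\<lambda>x. V s x - v x))\<^sup>2 + 2 * l2_inner I v (V s) - l2_inner I v v)
      \<longlongrightarrow> 0\<^sup>2 + 2 * l2_inner I v v - l2_inner I v v) F"
    by (intro tendsto_intros lim l2_tendsto_inner[OF v v V lim])
  moreover have "eventually (\<lambda>s. (l2_norm I (\<lambda>x. V s x - v x))\<^sup>2 + 2 * l2_inner I v (V s)
      - l2_inner I v v = l2_inner I (V s) (V s)) F"
    using V
  proof eventually_elim
    case (elim s)
    then show ?case using v
      by (simp add: l2_norm_square l2_inner_diff_left l2_inner_diff_right L2_diff
          l2_inner_commute[of I "V s" v])
  qed
  ultimately show ?thesis by (simp add: tendsto_cong)
qed

text \<open>
  With \<open>l2_tendsto_add\<close> this passes the product rule to the limit: one factor converges in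
  \<open>L\<^sup>2\<close>, the other uniformly, and \<open>F b - f c = (F - f) b + f (b - c)\<close>.
\<close>

lemma l2_tendsto_mult:
  fixes F b :: "nat \<Rightarrow> real \<Rightarrow> real"
  assumes f: "f \<in> L2 I" and F: "\<And>k. F k \<in> L2 I"
    and F_lim: "(\<lambda>k. l2_norm I (\<lambda>x. F k x - f x)) \<longlonglongrightarrow> 0"
    and b: "\<And>k. b k \<in> borel_measurable (lebesgue_on I)" and c: "c \<in> borel_measurable (lebesgue_on I)"
    and C: "\<And>x. x \<in> I \<Longrightarrow> \<bar>c x\<bar> \<le> C" "0 \<le> C"
    and b_lim: "uniform_limit I b c sequentially"
  shows "(\<lambda>k. l2_norm I (\<lambda>x. F k x * b k x - f x * c x)) \<longlonglongrightarrow> 0"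
proof (rule tendstoI)
  fix e :: real assume e: "0 < e"
  define \<delta> where "\<delta> = min 1 (e / (2 * (l2_norm I f + 1)))"
  have f0: "l2_norm I f \<ge> 0" by (rule l2_norm_nonneg)
  have \<delta>: "0 < \<delta>" "\<delta> \<le> 1" using e f0 by (auto simp: \<delta>_def)
  have "\<delta> * l2_norm I f \<le> e / (2 * (l2_norm I f + 1)) * l2_norm I f"
    using f0 by (intro mult_right_mono) (auto simp: \<delta>_def)
  also have "\<dots> < e / 2" using e f0 by (simp add: field_simps)
  finally have \<delta>f: "\<delta> * l2_norm I f < e / 2" .
  have "(\<lambda>k. (C + 1) * l2_norm I (\<lambda>x. F k x - f x)) \<longlonglongrightarrow> (C + 1) * 0"
    by (intro tendsto_intros F_lim)
  then have "eventually (\<lambda>k. (C + 1) * l2_norm I (\<lambda>x. F k x - f x) < e / 2) sequentially"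
    using e by (intro order_tendstoD(2)) auto
  with uniform_limitD[OF b_lim \<delta>(1)]
  show "eventually (\<lambda>k. dist (l2_norm I (\<lambda>x. F k x * b k x - f x * c x)) 0 < e) sequentially"
  proof eventually_elim
    case (elim k)
    have close: "\<bar>b k x - c x\<bar> \<le> \<delta>" if "x \<in> I" for x
      using elim(1) that by (auto simp: dist_real_def)
    have bk: "\<bar>b k x\<bar> \<le> C + 1" if "x \<in> I" for x
      using close[OF that] C(1)[OF that] \<delta> by linarith
    have Ff: "(\<lambda>x. F k x - f x) \<in> L2 I" by (intro L2_diff F f)
    have bc: "(\<lambda>x. b k x - c x) \<in> borel_measurable (lebesgue_on I)" using b c by simp
    have "l2_norm I (\<lambda>x. F k x * b k x - f x * c x)
        = l2_norm I (\<lambda>x. (F k x - f x) * b k x + f x * (b k x - c x))"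
      by (simp add: algebra_simps)
    also have "\<dots> \<le> l2_norm I (\<lambda>x. (F k x - f x) * b k x) + l2_norm I (\<lambda>x. f x * (b k x - c x))"
      by (rule l2_norm_triangle[OF L2_mult_bounded[OF Ff b bk] L2_mult_bounded[OF f bc close]])
    also have "\<dots> \<le> (C + 1) * l2_norm I (\<lambda>x. F k x - f x) + \<delta> * l2_norm I f"
      using C \<delta> by (intro add_mono l2_norm_mult_bounded Ff b bk f bc close) auto
    also have "\<dots> < e" using elim(2) \<delta>f by simp
    finally show ?case by (simp add: l2_norm_nonneg)
  qed
qed

lemma l2_tendsto_add:
  assumes f: "f \<in> L2 I" and g: "g \<in> L2 I" and F: "\<And>k. F k \<in> L2 I" and G: "\<And>k. G k \<in> L2 I"
    and F_lim: "((\<lambda>k. l2_norm I (\<lambda>x. F k x - f x)) \<longlongrightarrow> 0) X"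
    and G_lim: "((\<lambda>k. l2_norm I (\<lambda>x. G k x - g x)) \<longlongrightarrow> 0) X"
  shows "((\<lambda>k. l2_norm I (\<lambda>x. (F k x + G k x) - (f x + g x))) \<longlongrightarrow> 0) X"
proof (rule Lim_null_comparison)
  show "((\<lambda>k. l2_norm I (\<lambda>x. F k x - f x) + l2_norm I (\<lambda>x. G k x - g x)) \<longlongrightarrow> 0) X"
    using tendsto_add[OF F_lim G_lim] by simp
  have "l2_norm I (\<lambda>x. (F k x + G k x) - (f x + g x))
      \<le> l2_norm I (\<lambda>x. F k x - f x) + l2_norm I (\<lambda>x. G k x - g x)" for k
    using l2_norm_triangle[OF L2_diff[OF F f] L2_diff[OF G g], of k k] by (simp add: algebra_simps)
  then show "eventually (\<lambda>k. norm (l2_norm I (\<lambda>x. (F k x + G k x) - (f x + g x)))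
      \<le> l2_norm I (\<lambda>x. F k x - f x) + l2_norm I (\<lambda>x. G k x - g x)) X"
    by (simp add: l2_norm_nonneg)
qed

lemma l2_tendsto_dominated:
  fixes F :: "nat \<Rightarrow> real \<Rightarrow> real"
  assumes F: "\<And>k. F k \<in> borel_measurable (lebesgue_on I)" and f: "f \<in> borel_measurable (lebesgue_on I)"
    and h: "h \<in> L2 I"
    and lim: "AE x in lebesgue_on I. (\<lambda>k. F k x) \<longlonglongrightarrow> f x"
    and le: "\<And>k. AE x in lebesgue_on I. \<bar>F k x - f x\<bar> \<le> h x"
  shows "(\<lambda>k. l2_norm I (\<lambda>x. F k x - f x)) \<longlonglongrightarrow> 0"
proof -
  have "(\<lambda>k. LINT x|lebesgue_on I. (F k x - f x)\<^sup>2) \<longlonglongrightarrow> (LINT x|lebesgue_on I. 0)"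
  proof (rule integral_dominated_convergence[where w = "\<lambda>x. (h x)\<^sup>2"])
    show "AE x in lebesgue_on I. (\<lambda>k. (F k x - f x)\<^sup>2) \<longlonglongrightarrow> 0"
      using lim
    proof eventually_elim
      case (elim x)
      have "(\<lambda>k. (F k x - f x)\<^sup>2) \<longlonglongrightarrow> (f x - f x)\<^sup>2" by (intro tendsto_intros elim)
      then show ?case by simp
    qed
    show "AE x in lebesgue_on I. norm ((F k x - f x)\<^sup>2) \<le> (h x)\<^sup>2" for k
      using le[of k]
    proof eventually_elim
      case (elim x)
      from power_mono[OF elim, of 2] show ?case by simp
    qed
  qed (use F f in \<open>auto intro: L2_square[OF h]\<close>)
  then have "(\<lambda>k. sqrt (LINT x|lebesgue_on I. (F k x - f x)\<^sup>2)) \<longlonglongrightarrow> sqrt 0"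
    by (intro tendsto_real_sqrt) simp
  then show ?thesis by (simp add: l2_norm_def l2_inner_def power2_eq_square)
qed

section \<open>Minimality of the velocity of a gradient flow\<close>

text \<open>
  A mean value inequality for one-sided (upper Dini) derivatives. The points up to which \<open>f\<close> grows with
  slope at most \<open>e\<close> form a closed set whose supremum can only be the right end, since the
  right-derivative bound would otherwise push it further.
\<close>

lemma nonincreasing_of_right_derivative_le_0:
  fixes f :: "real \<Rightarrow> real"
  assumes "a \<le> b" and cont: "continuous_on {a..b} f"
    and right: "\<And>s e. a < s \<Longrightarrow> s < b \<Longrightarrow> 0 < e \<Longrightarrow>
      eventually (\<lambda>h. f (s + h) - f s \<le> e * h) (at_right 0)"
  shows "f b \<le> f a"
proof (cases "a = b")
  case False
  with \<open>a \<le> b\<close> have ab: "a < b" by simp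
  have inner: "f b - f c \<le> e * (b - c)" if c: "a < c" "c < b" and e: "0 < e" for c e
  proof -
    define S where "S = {s \<in> {c..b}. f s - e * s \<le> f c - e * c}"
    have contc: "continuous_on {c..b} (\<lambda>s. f s - e * s)"
      using c by (intro continuous_intros continuous_on_subset[OF cont]) auto
    have "closed S"
    proof -
      have "S = {c..b} \<inter> (\<lambda>s. f s - e * s) -` {..f c - e * c}" by (auto simp: S_def)
      then show ?thesis using continuous_closed_preimage[OF contc] by simp
    qed
    moreover have "c \<in> S" using c by (simp add: S_def)
    moreover have bdd: "bdd_above S" by (rule bdd_aboveI[of _ b]) (simp add: S_def)
    ultimately have m: "Sup S \<in> S" using closed_contains_Sup by blast
    have "Sup S = b"
    proof (rule ccontr)
      assume "Sup S \<noteq> b"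
      with m c have mb: "a < Sup S" "Sup S < b" by (auto simp: S_def)
      have "eventually (\<lambda>h. h < b - Sup S) (at_right (0::real))"
        using mb by (intro eventually_at_rightI[of 0 "b - Sup S"]) auto
      with right[OF mb e] eventually_at_right_less[of "0::real"]
      have "eventually (\<lambda>h. Sup S + h \<in> S \<and> 0 < h) (at_right 0)"
      proof eventually_elim
        case (elim h)
        have "f (Sup S) - e * Sup S \<le> f c - e * c" "c \<le> Sup S" using m by (simp_all add: S_def)
        then show ?case using elim by (simp add: S_def distrib_left)
      qed
      then obtain h where "Sup S + h \<in> S" "0 < h"
        using eventually_happens'[OF trivial_limit_at_right_real] by blast
      with cSup_upper[OF _ bdd, of "Sup S + h"] show False by simp
    qed
    with m have "f b - e * b \<le> f c - e * c" by (simp add: S_def)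
    then show ?thesis by (simp add: right_diff_distrib)
  qed
  have le: "f b \<le> f c" if c: "a < c" "c < b" for c
  proof (rule field_le_epsilon)
    fix d :: real assume "0 < d"
    with inner[OF c, of "d / (b - c)"] c show "f b \<le> f c + d" by simp
  qed
  have "(f \<longlongrightarrow> f a) (at_right a)"
    using cont ab by (simp add: continuous_on_Icc_at_rightD)
  moreover have "eventually (\<lambda>c. f b \<le> f c) (at_right a)"
    using ab le by (intro eventually_at_rightI[of a b]) auto
  ultimately show ?thesis
    by (rule tendsto_lowerbound) simp
qed simp

lemma subdiff_L2: "p \<in> subdiff I J u \<Longrightarrow> p \<in> L2 I"
  and subdiff_eq: "p \<in> subdiff I J u \<Longrightarrow> J u = ereal (l2_inner I p u)"
  and subdiff_le: "p \<in> subdiff I J u \<Longrightarrow> v \<in> L2 I \<Longrightarrow> ereal (l2_inner I p v) \<le> J v"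
  by (auto simp: subdiff_def)

lemma subdiff_monotone:
  assumes p: "p \<in> subdiff I J u" and q: "q \<in> subdiff I J v" and u: "u \<in> L2 I" and v: "v \<in> L2 I"
  shows "l2_inner I q (\<lambda>x. u x - v x) \<le> l2_inner I p (\<lambda>x. u x - v x)"
  using subdiff_le[OF p v] subdiff_le[OF q u] subdiff_L2[OF p] subdiff_L2[OF q] u v
  by (simp add: subdiff_eq[OF p] subdiff_eq[OF q] l2_inner_diff_right)

text \<open>
  This is the variational inequality that characterises \<open>p(t)\<close> as the projection of \<open>0\<close> onto
  the convex set \<open>\<partial>J(u(t))\<close>.
\<close>

lemma gradient_flow_variational:
  assumes flow: "gradient_flow I J f u p" and t: "0 < t" and q: "q \<in> subdiff I J (u t)"
  shows "l2_inner I (p t) (p t) \<le> l2_inner I q (p t)"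
proof -
  have uL: "u s \<in> L2 I" if "0 \<le> s" for s using flow that by (auto simp: gradient_flow_def)
  have pL: "p s \<in> L2 I" if "0 < s" for s using flow that by (auto simp: gradient_flow_def)
  have pS: "p s \<in> subdiff I J (u s)" if "0 < s" for s
    using flow that by (auto simp: gradient_flow_def)
  have ucont: "((\<lambda>r. l2_norm I (\<lambda>x. u r x - u s x)) \<longlongrightarrow> 0) (at s within {0..})" if "0 \<le> s" for s
    using flow that unfolding gradient_flow_def by blast
  have qL: "q \<in> L2 I" using q by (rule subdiff_L2)
  define d where "d s h = (\<lambda>x. (u (s + h) x - u s x) / h)" for s h
  have dL: "d s h \<in> L2 I" if "0 < s" "0 < h" for s h
    unfolding d_def using that by (intro L2_divide L2_diff uL) auto
  have dL': "eventually (\<lambda>h. d s h \<in> L2 I) (at_right 0)" if "0 < s" for s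
    using eventually_at_right_less[of "0::real"] by eventually_elim (rule dL[OF that])
  have dlim: "((\<lambda>h. l2_norm I (\<lambda>x. d s h x - (- p s x))) \<longlongrightarrow> 0) (at_right 0)" if "0 < s" for s
    using flow that unfolding gradient_flow_def d_def by blast
  define A where "A h = (\<lambda>x. u (t + h) x - u t x)" for h
  have AL: "A h \<in> L2 I" if "0 \<le> h" for h
    unfolding A_def using that t by (intro L2_diff uL) auto
  have A_d: "A h = (\<lambda>x. h * d t h x)" if "0 < h" for h
    using that by (simp add: A_def d_def)
  have A_step: "A (h + k) = (\<lambda>x. A h x + k * d (t + h) k x)" if "0 < k" for h k
    using that by (simp add: A_def d_def add.assoc)
  have "l2_inner I (p t) (p t) \<le> l2_inner I q (p t) + l2_norm I q * \<eta>" if \<eta>: "0 < \<eta>" for \<eta>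
  proof -
    \<comment> \<open>The error \<open>\<eta>\<close> in the difference quotient costs at most \<open>\<parallel>q\<parallel> \<eta>\<close>.\<close>
    define K where "K = l2_inner I q (p t) + l2_norm I q * \<eta>"
    have "eventually (\<lambda>h. l2_norm I (\<lambda>x. d t h x - (- p t x)) < \<eta>) (at_right 0)"
      using order_tendstoD(2)[OF dlim[OF t] \<eta>] .
    then obtain h0 where h0: "0 < h0"
      and small: "\<And>h. 0 < h \<Longrightarrow> h < h0 \<Longrightarrow> l2_norm I (\<lambda>x. d t h x - (- p t x)) < \<eta>"
      by (auto simp: eventually_at_right_field)
    have bound: "l2_inner I (d t h) (d t h) \<le> K" if h: "0 < h" "h < h0" for h
    proof -
      \<comment> \<open>The comparison function \<open>k\<^sup>2 K / 2\<close> has derivative \<open>k K\<close>, the bound for the derivative of \<open>\<parallel>u(t + k) - u(t)\<parallel>\<^sup>2 / 2\<close>.\<close>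
      define G where "G k = l2_inner I (A k) (A k) / 2 - k\<^sup>2 / 2 * K" for k
      have "G h \<le> G 0"
      proof (rule nonincreasing_of_right_derivative_le_0[where f = G and a = 0 and b = h])
        show "0 \<le> h" using h by simp
        show "continuous_on {0..h} G"
          unfolding continuous_on_def
        proof
          fix k assume k: "k \<in> {0..h}"
          have "((\<lambda>s. l2_norm I (\<lambda>x. u s x - u (t + k) x)) \<longlongrightarrow> 0) (at (t + k) within {0..})"
            using ucont[of "t + k"] k t by simp
          then have "((\<lambda>r. l2_norm I (\<lambda>x. u (t + r) x - u (t + k) x)) \<longlongrightarrow> 0) (at k within {0..h})"
          proof (rule filterlim_compose)
            have "((\<lambda>r. t + r) \<longlongrightarrow> t + k) (at k within {0..h})"
              by (intro tendsto_intros)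
            then show "filterlim (\<lambda>r. t + r) (at (t + k) within {0..}) (at k within {0..h})"
              unfolding filterlim_at using t by (simp add: eventually_at_filter)
          qed
          then have "((\<lambda>r. l2_norm I (\<lambda>x. A r x - A k x)) \<longlongrightarrow> 0) (at k within {0..h})"
            by (simp add: A_def)
          moreover have "eventually (\<lambda>r. A r \<in> L2 I) (at k within {0..h})"
            by (auto simp: eventually_at_filter AL)
          ultimately have "((\<lambda>r. l2_inner I (A r) (A r)) \<longlongrightarrow> l2_inner I (A k) (A k)) (at k within {0..h})"
            using k by (intro l2_tendsto_inner_self AL) auto
          then show "(G \<longlongrightarrow> G k) (at k within {0..h})"
            unfolding G_def by (intro tendsto_intros) auto
        qed
      next
        fix s e :: real assume s: "0 < s" "s < h" and e: "0 < e"
        have ts: "0 < t + s" using s t by simp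
        have pm: "(\<lambda>x. - p (t + s) x) \<in> L2 I" using pL[OF ts] by blast
        \<comment> \<open>\<open>?B k\<close> is the difference quotient of \<open>G\<close> at \<open>s\<close> with increment \<open>k\<close>.\<close>
        let ?B = "\<lambda>k. l2_inner I (A s) (d (t + s) k) + k / 2 * l2_inner I (d (t + s) k) (d (t + s) k)
          - s * K - k / 2 * K"
        have "(?B \<longlongrightarrow> l2_inner I (A s) (\<lambda>x. - p (t + s) x)
            + 0 / 2 * l2_inner I (\<lambda>x. - p (t + s) x) (\<lambda>x. - p (t + s) x) - s * K - 0 / 2 * K) (at_right 0)"
          using s by (intro tendsto_intros l2_tendsto_inner l2_tendsto_inner_self pm AL dL' dlim ts) auto
        moreover have "l2_inner I (A s) (\<lambda>x. - p (t + s) x) - s * K \<le> 0"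
        proof -
          \<comment> \<open>Monotonicity replaces the unknown \<open>p(t + s)\<close> by the fixed \<open>q\<close>.\<close>
          have "l2_inner I q (A s) \<le> l2_inner I (p (t + s)) (A s)"
            unfolding A_def using ts t s by (intro subdiff_monotone[OF pS q] uL) auto
          moreover have "l2_inner I q (A s)
              = s * (l2_inner I q (\<lambda>x. d t s x - (- p t x)) - l2_inner I q (p t))"
            using s qL pL[OF t] dL[OF t, of s]
            by (simp add: A_d l2_inner_scale_right l2_inner_add_right)
          moreover have "- l2_inner I q (\<lambda>x. d t s x - (- p t x)) \<le> l2_norm I q * \<eta>"
          proof -
            have "(\<lambda>x. d t s x - (- p t x)) \<in> L2 I"
              using dL[OF t, of s] pL[OF t] s by (intro L2_diff L2_uminus) auto
            then have "- l2_inner I q (\<lambda>x. d t s x - (- p t x))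
                \<le> l2_norm I q * l2_norm I (\<lambda>x. d t s x - (- p t x))"
              using l2_Cauchy_Schwarz[OF qL, of "\<lambda>x. d t s x - (- p t x)"] by linarith
            also have "\<dots> \<le> l2_norm I q * \<eta>"
              using small[of s] s h by (intro mult_left_mono l2_norm_nonneg) auto
            finally show ?thesis .
          qed
          then have "s * (- l2_inner I q (\<lambda>x. d t s x - (- p t x))) \<le> s * (l2_norm I q * \<eta>)"
            using s by (intro mult_left_mono) auto
          ultimately show ?thesis
            unfolding l2_inner_uminus_right l2_inner_commute[of I "A s"] K_def
            by (simp add: algebra_simps)
        qed
        ultimately have "eventually (\<lambda>k. ?B k < e) (at_right 0)"
          using e by (elim order_tendstoD(2)) simp
        with eventually_at_right_less[of "0::real"]
        show "eventually (\<lambda>k. G (s + k) - G s \<le> e * k) (at_right 0)"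
        proof eventually_elim
          case (elim k)
          have "l2_inner I (A (s + k)) (A (s + k)) = l2_inner I (A s) (A s)
              + 2 * k * l2_inner I (A s) (d (t + s) k) + k\<^sup>2 * l2_inner I (d (t + s) k) (d (t + s) k)"
            using elim AL[of s] dL[OF ts, of k] s
            by (simp add: A_step[of k s] l2_inner_square_add_scale)
          then have "G (s + k) - G s = ?B k * k"
            unfolding G_def by (simp add: power2_eq_square field_simps)
          also have "\<dots> \<le> e * k" using elim by (intro mult_right_mono) auto
          finally show ?case .
        qed
      qed
      also have "G 0 = 0" by (simp add: G_def A_def l2_inner_def)
      finally have "h\<^sup>2 * l2_inner I (d t h) (d t h) \<le> h\<^sup>2 * K"
        using h unfolding G_def A_d[OF h(1)] l2_inner_scale_left l2_inner_scale_right
        by (simp add: power2_eq_square)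
      then show ?thesis using h by simp
    qed
    have "((\<lambda>h. l2_inner I (d t h) (d t h))
        \<longlongrightarrow> l2_inner I (\<lambda>x. - p t x) (\<lambda>x. - p t x)) (at_right 0)"
      by (intro l2_tendsto_inner_self dL' dlim t L2_uminus pL)
    moreover have "eventually (\<lambda>h. l2_inner I (d t h) (d t h) \<le> K) (at_right 0)"
      using h0 bound by (intro eventually_at_rightI[of 0 h0]) auto
    ultimately have "l2_inner I (\<lambda>x. - p t x) (\<lambda>x. - p t x) \<le> K"
      by (rule tendsto_upperbound) simp
    then show ?thesis by (simp add: K_def l2_inner_def)
  qed
  then have *: "l2_inner I (p t) (p t) - l2_inner I q (p t) \<le> l2_norm I q * \<eta>" if "0 < \<eta>" for \<eta>
    using that by (simp add: algebra_simps)
  show ?thesis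
  proof (rule field_le_epsilon)
    fix e :: real assume e: "0 < e"
    let ?N = "l2_norm I q + 1"
    have N: "?N > 0" using l2_norm_nonneg[of I q] by simp
    have "l2_norm I q * (e / ?N) \<le> ?N * (e / ?N)"
      using e N by (intro mult_right_mono) auto
    also have "\<dots> = e" using N by simp
    finally show "l2_inner I (p t) (p t) \<le> l2_inner I q (p t) + e"
      using *[of "e / ?N"] e N by simp
  qed
qed

section \<open>Test functions of the total variation\<close>

lemma L2_continuous:
  assumes "continuous_on UNIV g"
  shows "g \<in> L2 {a<..<b}"
proof -
  have meas: "h \<in> borel_measurable (lebesgue_on {a<..<b})" if "continuous_on UNIV h" for h :: "real \<Rightarrow> real"
    by (intro continuous_imp_measurable_on_sets_lebesgue continuous_on_subset[OF that]) auto
  have "continuous_on UNIV (\<lambda>x. (g x)\<^sup>2)" by (intro continuous_intros assms)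
  moreover have "bounded ((\<lambda>x. (g x)\<^sup>2) ` {a..b})"
    by (intro compact_imp_bounded compact_continuous_image continuous_on_subset[OF calculation]) auto
  then obtain B where "\<forall>x\<in>{a..b}. norm ((g x)\<^sup>2) \<le> B" unfolding bounded_iff by blast
  then have "integrable (lebesgue_on {a<..<b}) (\<lambda>x. (g x)\<^sup>2)"
    by (intro finite_measure.integrable_const_bound[where B = B] finite_measure_lebesgue_on
        meas calculation AE_I2) auto
  then show ?thesis using meas[OF assms] by (simp add: L2_def)
qed

lemma L2_indicator: "indicat_real {..<x} \<in> L2 {a<..<b}"
proof -
  have "indicat_real {..<x} \<in> borel_measurable (lebesgue_on {a<..<b})"
    by (intro measurable_restrict_space1 borel_measurable_indicator) auto
  from L2_mult_bounded[OF L2_continuous[OF continuous_on_const[of _ 1]] this, of 1]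
  show ?thesis by simp
qed

lemma L2_integrable:
  assumes "u \<in> L2 {a<..<b}"
  shows "integrable (lebesgue_on {a<..<b}) u"
  using L2_mult_integrable[OF assms L2_continuous[OF continuous_on_const[of _ 1]]] by simp

text \<open>
  Square-integrable functions on a bounded interval are integrable, and a function of infinite
  variation gets the value \<open>\<infinity>\<close> on both sides.
\<close>

lemma TV_eq_total_variation:
  "v \<in> L2 {a<..<b} \<Longrightarrow> TV {a<..<b} v = total_variation {a<..<b} v"
  by (auto simp: TV_def BV_def interior_open L2_integrable less_top)

lemma C1_compact_support_deriv:
  assumes "\<phi> \<in> C1_compact_support U"
  shows "(\<phi> has_real_derivative deriv \<phi> x) (at x)" and "continuous_on UNIV (deriv \<phi>)"
    and "continuous_on UNIV \<phi>"
proof -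
  obtain D where D: "\<And>x. (\<phi> has_vector_derivative D x) (at x)" "continuous_on UNIV D"
    using assms by (auto simp: C1_compact_support_def C1_differentiable_on_def)
  then have D': "(\<phi> has_real_derivative D x) (at x)" for x
    by (simp add: has_real_derivative_iff_has_vector_derivative)
  then have "deriv \<phi> = D" by (intro ext DERIV_imp_deriv)
  with D D' show "(\<phi> has_real_derivative deriv \<phi> x) (at x)" "continuous_on UNIV (deriv \<phi>)"
    by simp_all
  show "continuous_on UNIV \<phi>" using D' by (intro DERIV_continuous_on) auto
qed

lemma C1_compact_support_eq_0: "\<phi> \<in> C1_compact_support U \<Longrightarrow> x \<notin> U \<Longrightarrow> \<phi> x = 0"
  using closure_subset[of "{x. \<phi> x \<noteq> 0}"] unfolding C1_compact_support_def by blast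

lemma C1_compact_supportI:
  assumes "\<And>x. (\<phi> has_real_derivative D x) (at x)" and "continuous_on UNIV D"
    and "compact K" "K \<subseteq> U" "\<And>x. x \<notin> K \<Longrightarrow> \<phi> x = 0"
  shows "\<phi> \<in> C1_compact_support U" and "deriv \<phi> = D"
proof -
  have "closure {x. \<phi> x \<noteq> 0} \<subseteq> K"
    using assms by (intro closure_minimal compact_imp_closed) auto
  moreover from this have "compact (closure {x. \<phi> x \<noteq> 0})"
    using \<open>compact K\<close> by (metis closed_closure compact_Int_closed inf.absorb_iff2)
  ultimately show "\<phi> \<in> C1_compact_support U"
    using assms by (auto simp: C1_compact_support_def C1_differentiable_on_def
        has_real_derivative_iff_has_vector_derivative)
  show "deriv \<phi> = D" using assms by (intro ext DERIV_imp_deriv)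
qed

lemma C1_compact_support_add:
  assumes f: "\<phi> \<in> C1_compact_support U" and g: "\<psi> \<in> C1_compact_support U"
  shows "(\<lambda>x. \<phi> x + \<psi> x) \<in> C1_compact_support U"
    and "deriv (\<lambda>x. \<phi> x + \<psi> x) = (\<lambda>x. deriv \<phi> x + deriv \<psi> x)"
proof -
  let ?K = "closure {x. \<phi> x \<noteq> 0} \<union> closure {x. \<psi> x \<noteq> 0}"
  have K: "compact ?K" "?K \<subseteq> U" using f g by (auto simp: C1_compact_support_def)
  have 0: "\<phi> x + \<psi> x = 0" if "x \<notin> ?K" for x
    using that closure_subset[of "{x. \<phi> x \<noteq> 0}"] closure_subset[of "{x. \<psi> x \<noteq> 0}"]
    by (metis (mono_tags, lifting) UnCI add_0 mem_Collect_eq subsetD)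
  have D: "((\<lambda>x. \<phi> x + \<psi> x) has_real_derivative deriv \<phi> x + deriv \<psi> x) (at x)" for x
    by (intro derivative_intros C1_compact_support_deriv[OF f] C1_compact_support_deriv[OF g])
  have c: "continuous_on UNIV (\<lambda>x. deriv \<phi> x + deriv \<psi> x)"
    by (intro continuous_intros C1_compact_support_deriv[OF f] C1_compact_support_deriv[OF g])
  show "(\<lambda>x. \<phi> x + \<psi> x) \<in> C1_compact_support U"
    and "deriv (\<lambda>x. \<phi> x + \<psi> x) = (\<lambda>x. deriv \<phi> x + deriv \<psi> x)"
    using C1_compact_supportI[OF D c K 0] by auto
qed

lemma C1_compact_support_mult:
  assumes f: "\<phi> \<in> C1_compact_support U" and g: "\<psi> \<in> C1_compact_support U"
  shows "(\<lambda>x. \<phi> x * \<psi> x) \<in> C1_compact_support U"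
    and "deriv (\<lambda>x. \<phi> x * \<psi> x) = (\<lambda>x. deriv \<phi> x * \<psi> x + deriv \<psi> x * \<phi> x)"
proof -
  let ?K = "closure {x. \<phi> x \<noteq> 0}"
  have K: "compact ?K" "?K \<subseteq> U" using f g by (auto simp: C1_compact_support_def)
  have 0: "\<phi> x * \<psi> x = 0" if "x \<notin> ?K" for x
    using that closure_subset[of "{x. \<phi> x \<noteq> 0}"] by auto
  have D: "((\<lambda>x. \<phi> x * \<psi> x) has_real_derivative deriv \<phi> x * \<psi> x + deriv \<psi> x * \<phi> x) (at x)" for x
    by (intro derivative_intros C1_compact_support_deriv[OF f] C1_compact_support_deriv[OF g])
  have c: "continuous_on UNIV (\<lambda>x. deriv \<phi> x * \<psi> x + deriv \<psi> x * \<phi> x)"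
    by (intro continuous_intros C1_compact_support_deriv[OF f] C1_compact_support_deriv[OF g])
  show "(\<lambda>x. \<phi> x * \<psi> x) \<in> C1_compact_support U"
    and "deriv (\<lambda>x. \<phi> x * \<psi> x) = (\<lambda>x. deriv \<phi> x * \<psi> x + deriv \<psi> x * \<phi> x)"
    using C1_compact_supportI[OF D c K 0] by auto
qed

lemma C1_compact_support_scale:
  assumes f: "\<phi> \<in> C1_compact_support U"
  shows "(\<lambda>x. c * \<phi> x) \<in> C1_compact_support U"
    and "deriv (\<lambda>x. c * \<phi> x) = (\<lambda>x. c * deriv \<phi> x)"
proof -
  let ?K = "closure {x. \<phi> x \<noteq> 0}"
  have K: "compact ?K" "?K \<subseteq> U" using f by (auto simp: C1_compact_support_def)
  have 0: "c * \<phi> x = 0" if "x \<notin> ?K" for x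
    using that closure_subset[of "{x. \<phi> x \<noteq> 0}"] by auto
  have D: "((\<lambda>x. c * \<phi> x) has_real_derivative c * deriv \<phi> x) (at x)" for x
    by (intro DERIV_cmult C1_compact_support_deriv[OF f])
  have c: "continuous_on UNIV (\<lambda>x. c * deriv \<phi> x)"
    by (intro continuous_intros C1_compact_support_deriv[OF f])
  show "(\<lambda>x. c * \<phi> x) \<in> C1_compact_support U"
    and "deriv (\<lambda>x. c * \<phi> x) = (\<lambda>x. c * deriv \<phi> x)"
    using C1_compact_supportI[OF D c K 0] by auto
qed

lemma C1_compact_support_deriv_L2: "\<phi> \<in> C1_compact_support U \<Longrightarrow> deriv \<phi> \<in> L2 {a<..<b}"
  by (intro L2_continuous C1_compact_support_deriv)

text \<open>
  Written as an inner product with a step function, the fundamental theorem of calculus both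
  computes the variation of a step function and turns \<open>L\<^sup>2\<close>-convergence of derivatives into
  uniform convergence.
\<close>

lemma C1_compact_support_FTC:
  assumes \<phi>: "\<phi> \<in> C1_compact_support {a<..<b}" and x: "a < x" "x \<le> b"
  shows "l2_inner {a<..<b} (deriv \<phi>) (indicat_real {..<x}) = \<phi> x"
proof -
  have int: "integrable (lebesgue_on {a<..<x}) (deriv \<phi>)"
    by (intro L2_integrable C1_compact_support_deriv_L2[OF \<phi>])
  have "l2_inner {a<..<b} (deriv \<phi>) (indicat_real {..<x})
      = (LINT t|lebesgue. indicator {a<..<b} t *\<^sub>R (deriv \<phi> t * indicat_real {..<x} t))"
    by (simp add: l2_inner_def integral_restrict_space)
  also have "\<dots> = (LINT t|lebesgue. indicator {a<..<x} t *\<^sub>R deriv \<phi> t)"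
    using x by (intro Bochner_Integration.integral_cong) (auto simp: indicator_def)
  also have "\<dots> = (LINT t|lebesgue_on {a<..<x}. deriv \<phi> t)"
    by (simp add: integral_restrict_space)
  also have "\<dots> = integral {a<..<x} (deriv \<phi>)"
    by (intro lebesgue_integral_eq_integral int) simp
  also have "\<dots> = integral {a..x} (deriv \<phi>)"
    by (rule integral_open_interval_real[symmetric])
  also have "\<dots> = \<phi> x - \<phi> a"
    using x C1_compact_support_deriv(1)[OF \<phi>]
    by (intro integral_unique fundamental_theorem_of_calculus)
      (auto simp: has_real_derivative_iff_has_vector_derivative[symmetric] intro: has_field_derivative_at_within)
  also have "\<phi> a = 0" using C1_compact_support_eq_0[OF \<phi>] by simp
  finally show ?thesis by simp
qed

lemma l2_norm_indicator_le:
  "l2_norm {a<..<b} (indicat_real {..<x}) \<le> l2_norm {a<..<b} (\<lambda>x. 1)"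
proof -
  have "indicat_real {..<x} \<in> borel_measurable (lebesgue_on {a<..<b})"
    by (rule L2_borel[OF L2_indicator])
  from l2_norm_mult_bounded[OF L2_continuous[OF continuous_on_const[of _ 1]] this, of 1]
  show ?thesis by simp
qed

section \<open>Functions in the Sobolev space with zero boundary values\<close>

text \<open>
  \<open>w\<close> lies in \<open>H\<^sup>1\<^sub>0(a,b)\<close> and has the weak derivative \<open>g\<close>. Defining the space as a closure of the test
  functions, with uniform convergence of the functions themselves, lets the product rule
  and the bound by the total variation follow by passing to the limit.
\<close>

definition H10 :: "real \<Rightarrow> real \<Rightarrow> (real \<Rightarrow> real) \<Rightarrow> (real \<Rightarrow> real) \<Rightarrow> bool" where
  "H10 a b w g \<longleftrightarrow> g \<in> L2 {a<..<b} \<and>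
     (\<exists>\<psi>. (\<forall>k. \<psi> k \<in> C1_compact_support {a<..<b}) \<and>
        uniform_limit {a<..<b} \<psi> w sequentially \<and>
        (\<lambda>k. l2_norm {a<..<b} (\<lambda>x. deriv (\<psi> k) x - g x)) \<longlonglongrightarrow> 0)"

lemma H10_L2: "H10 a b w g \<Longrightarrow> g \<in> L2 {a<..<b}"
  by (simp add: H10_def)

lemma H10_C1_compact_support:
  assumes "\<phi> \<in> C1_compact_support {a<..<b}"
  shows "H10 a b \<phi> (deriv \<phi>)"
  unfolding H10_def
  using assms by (intro conjI exI[of _ "\<lambda>_. \<phi>"] C1_compact_support_deriv_L2[OF assms])
    (auto simp: l2_norm_def l2_inner_def uniform_limit_iff)

lemma H10_bounded:
  assumes "H10 a b w g"
  obtains C where "0 \<le> C" "\<And>x. x \<in> {a<..<b} \<Longrightarrow> \<bar>w x\<bar> \<le> C"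
proof -
  obtain \<psi> where \<psi>: "\<And>k. \<psi> k \<in> C1_compact_support {a<..<b}"
    and lim: "uniform_limit {a<..<b} \<psi> w sequentially"
    using assms by (auto simp: H10_def)
  have "eventually (\<lambda>k. \<forall>x\<in>{a<..<b}. dist (\<psi> k x) (w x) < 1) sequentially"
    using uniform_limitD[OF lim, of 1] by simp
  then obtain k :: nat where k: "\<forall>x\<in>{a<..<b}. dist (\<psi> k x) (w x) < 1"
    using eventually_happens by fastforce
  have "bounded (\<psi> k ` {a..b})"
    by (intro compact_imp_bounded compact_continuous_image
        continuous_on_subset[OF C1_compact_support_deriv(3)[OF \<psi>]]) auto
  then obtain B where B: "B > 0" "\<And>x. x \<in> {a..b} \<Longrightarrow> \<bar>\<psi> k x\<bar> \<le> B"
    by (auto simp: bounded_pos)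
  have "\<bar>w x\<bar> \<le> B + 1" if "x \<in> {a<..<b}" for x
  proof -
    have "\<bar>\<psi> k x - w x\<bar> < 1" using k that by (simp add: dist_real_def)
    moreover have "\<bar>\<psi> k x\<bar> \<le> B" using B(2) that by simp
    ultimately show ?thesis by linarith
  qed
  with \<open>B > 0\<close> show thesis by (intro that[of "B + 1"]) auto
qed

lemma H10_borel:
  assumes "H10 a b w g"
  shows "w \<in> borel_measurable (lebesgue_on {a<..<b})"
proof -
  obtain \<psi> where \<psi>: "\<And>k. \<psi> k \<in> C1_compact_support {a<..<b}"
    and lim: "uniform_limit {a<..<b} \<psi> w sequentially"
    using assms by (auto simp: H10_def)
  have "continuous_on {a<..<b} w"
    by (rule uniform_limit_theorem[OF _ lim])
      (auto intro!: always_eventually continuous_on_subset[OF C1_compact_support_deriv(3)[OF \<psi>]])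
  then show ?thesis by (intro continuous_imp_measurable_on_sets_lebesgue) auto
qed

lemma H10_add:
  assumes "H10 a b v f" and "H10 a b w g"
  shows "H10 a b (\<lambda>x. v x + w x) (\<lambda>x. f x + g x)"
proof -
  obtain \<phi> where \<phi>: "\<And>k. \<phi> k \<in> C1_compact_support {a<..<b}"
    "uniform_limit {a<..<b} \<phi> v sequentially"
    "(\<lambda>k. l2_norm {a<..<b} (\<lambda>x. deriv (\<phi> k) x - f x)) \<longlonglongrightarrow> 0"
    using assms(1) by (auto simp: H10_def)
  obtain \<psi> where \<psi>: "\<And>k. \<psi> k \<in> C1_compact_support {a<..<b}"
    "uniform_limit {a<..<b} \<psi> w sequentially"
    "(\<lambda>k. l2_norm {a<..<b} (\<lambda>x. deriv (\<psi> k) x - g x)) \<longlonglongrightarrow> 0"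
    using assms(2) by (auto simp: H10_def)
  show ?thesis
    unfolding H10_def
  proof (intro conjI exI[of _ "\<lambda>k x. \<phi> k x + \<psi> k x"] allI)
    show "(\<lambda>k. l2_norm {a<..<b} (\<lambda>x. deriv (\<lambda>x. \<phi> k x + \<psi> k x) x - (f x + g x))) \<longlonglongrightarrow> 0"
      unfolding C1_compact_support_add(2)[OF \<phi>(1) \<psi>(1)]
      by (intro l2_tendsto_add C1_compact_support_deriv_L2[OF \<phi>(1)] C1_compact_support_deriv_L2[OF \<psi>(1)]
          H10_L2[OF assms(1)] H10_L2[OF assms(2)] \<phi>(3) \<psi>(3))
  qed (auto intro!: L2_add H10_L2[OF assms(1)] H10_L2[OF assms(2)] C1_compact_support_add \<phi> \<psi> uniform_limit_intros)
qed

lemma H10_mult: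
  assumes v: "H10 a b v f" and w: "H10 a b w g"
  shows "H10 a b (\<lambda>x. v x * w x) (\<lambda>x. f x * w x + g x * v x)"
proof -
  obtain \<phi> where \<phi>: "\<And>k. \<phi> k \<in> C1_compact_support {a<..<b}"
    "uniform_limit {a<..<b} \<phi> v sequentially"
    "(\<lambda>k. l2_norm {a<..<b} (\<lambda>x. deriv (\<phi> k) x - f x)) \<longlonglongrightarrow> 0"
    using v by (auto simp: H10_def)
  obtain \<psi> where \<psi>: "\<And>k. \<psi> k \<in> C1_compact_support {a<..<b}"
    "uniform_limit {a<..<b} \<psi> w sequentially"
    "(\<lambda>k. l2_norm {a<..<b} (\<lambda>x. deriv (\<psi> k) x - g x)) \<longlonglongrightarrow> 0"
    using w by (auto simp: H10_def)
  obtain A where A: "0 \<le> A" "\<And>x. x \<in> {a<..<b} \<Longrightarrow> \<bar>v x\<bar> \<le> A" using H10_bounded[OF v] by auto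
  obtain B where B: "0 \<le> B" "\<And>x. x \<in> {a<..<b} \<Longrightarrow> \<bar>w x\<bar> \<le> B" using H10_bounded[OF w] by auto
  note meas = H10_borel[OF v] H10_borel[OF w] H10_borel[OF H10_C1_compact_support[OF \<phi>(1)]]
    H10_borel[OF H10_C1_compact_support[OF \<psi>(1)]]
  have L2: "(\<lambda>x. f x * w x) \<in> L2 {a<..<b}" "(\<lambda>x. g x * v x) \<in> L2 {a<..<b}"
    using L2_mult_bounded[OF H10_L2[OF v] meas(2) B(2)] L2_mult_bounded[OF H10_L2[OF w] meas(1) A(2)]
    by auto
  have L2': "(\<lambda>x. deriv (\<phi> k) x * \<psi> k x) \<in> L2 {a<..<b}" "(\<lambda>x. deriv (\<psi> k) x * \<phi> k x) \<in> L2 {a<..<b}" for k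
    by (intro L2_continuous continuous_intros C1_compact_support_deriv[OF \<phi>(1)]
        C1_compact_support_deriv[OF \<psi>(1)])+
  show ?thesis
    unfolding H10_def
  proof (intro conjI exI[of _ "\<lambda>k x. \<phi> k x * \<psi> k x"] allI)
    show "(\<lambda>k. l2_norm {a<..<b} (\<lambda>x. deriv (\<lambda>x. \<phi> k x * \<psi> k x) x - (f x * w x + g x * v x))) \<longlonglongrightarrow> 0"
      unfolding C1_compact_support_mult(2)[OF \<phi>(1) \<psi>(1)]
    proof (rule l2_tendsto_add[OF L2 L2'])
      show "(\<lambda>k. l2_norm {a<..<b} (\<lambda>x. deriv (\<phi> k) x * \<psi> k x - f x * w x)) \<longlonglongrightarrow> 0"
        using B by (intro l2_tendsto_mult[where C = B] C1_compact_support_deriv_L2[OF \<phi>(1)]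
            H10_L2[OF v] \<phi>(3) \<psi>(2) meas) auto
      show "(\<lambda>k. l2_norm {a<..<b} (\<lambda>x. deriv (\<psi> k) x * \<phi> k x - g x * v x)) \<longlonglongrightarrow> 0"
        using A by (intro l2_tendsto_mult[where C = A] C1_compact_support_deriv_L2[OF \<psi>(1)]
            H10_L2[OF w] \<psi>(3) \<phi>(2) meas) auto
    qed
    show "uniform_limit {a<..<b} (\<lambda>k x. \<phi> k x * \<psi> k x) (\<lambda>x. v x * w x) sequentially"
    proof (intro uniform_lim_mult \<phi> \<psi>)
      show "bounded (v ` {a<..<b})" by (rule boundedI[of _ A]) (use A in auto)
      show "bounded (w ` {a<..<b})" by (rule boundedI[of _ B]) (use B in auto)
    qed
  qed (auto intro!: L2_add L2 C1_compact_support_mult \<phi> \<psi>)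
qed

lemma H10_scale:
  assumes v: "H10 a b v f"
  shows "H10 a b (\<lambda>x. c * v x) (\<lambda>x. c * f x)"
proof -
  obtain \<phi> where \<phi>: "\<And>k. \<phi> k \<in> C1_compact_support {a<..<b}"
    "uniform_limit {a<..<b} \<phi> v sequentially"
    "(\<lambda>k. l2_norm {a<..<b} (\<lambda>x. deriv (\<phi> k) x - f x)) \<longlonglongrightarrow> 0"
    using v by (auto simp: H10_def)
  show ?thesis
    unfolding H10_def
  proof (intro conjI exI[of _ "\<lambda>k x. c * \<phi> k x"] allI)
    have "(\<lambda>k. \<bar>c\<bar> * l2_norm {a<..<b} (\<lambda>x. deriv (\<phi> k) x - f x)) \<longlonglongrightarrow> \<bar>c\<bar> * 0"
      by (intro tendsto_intros \<phi>)
    then show "(\<lambda>k. l2_norm {a<..<b} (\<lambda>x. deriv (\<lambda>x. c * \<phi> k x) x - c * f x)) \<longlonglongrightarrow> 0"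
      unfolding C1_compact_support_scale(2)[OF \<phi>(1)]
      unfolding right_diff_distrib[symmetric] l2_norm_scale by simp
    show "uniform_limit {a<..<b} (\<lambda>k x. c * \<phi> k x) (\<lambda>x. c * v x) sequentially"
      by (intro bounded_linear_uniform_limit_intros \<phi>)
  qed (auto intro!: L2_scale H10_L2[OF v] C1_compact_support_scale \<phi>)
qed

lemma H10_power:
  assumes v: "H10 a b v f"
  shows "H10 a b (\<lambda>x. v x ^ Suc n) (\<lambda>x. f x * (real (Suc n) * v x ^ n))"
proof (induction n)
  case 0
  then show ?case using v by simp
next
  case (Suc n)
  have "(\<lambda>x. f x * v x ^ Suc n + f x * (real (Suc n) * v x ^ n) * v x)
      = (\<lambda>x. f x * (real (Suc (Suc n)) * v x ^ Suc n))"
    by (simp add: fun_eq_iff algebra_simps)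
  with H10_mult[OF v Suc] show ?case by simp
qed

text \<open>
  The derivatives of functions bounded by \<open>1\<close> lie in the polar set of the total variation. The approximating
  test functions are bounded by \<open>1 + \<delta>\<close> only, so they are rescaled by \<open>1 / (1 + \<delta>)\<close>.
\<close>

lemma H10_deriv_le_TV:
  assumes w: "H10 a b w g" and le: "\<And>x. x \<in> {a<..<b} \<Longrightarrow> \<bar>w x\<bar> \<le> 1" and v: "v \<in> L2 {a<..<b}"
  shows "ereal (l2_inner {a<..<b} g v) \<le> TV {a<..<b} v"
proof (cases "TV {a<..<b} v")
  case MInf
  have "(\<lambda>x. 0) \<in> C1_compact_support {a<..<b}"
    by (auto simp: C1_compact_support_def)
  then have "ereal (LINT x|lebesgue_on {a<..<b}. v x * deriv (\<lambda>x. 0) x) \<le> TV {a<..<b} v"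
    unfolding TV_eq_total_variation[OF v] total_variation_def by (intro SUP_upper) auto
  with MInf show ?thesis by simp
next
  case (real T)
  have test: "l2_inner {a<..<b} v (deriv \<phi>) \<le> T"
    if "\<phi> \<in> C1_compact_support {a<..<b}" "\<And>x. \<bar>\<phi> x\<bar> \<le> 1" for \<phi>
  proof -
    have "ereal (LINT x|lebesgue_on {a<..<b}. v x * deriv \<phi> x) \<le> TV {a<..<b} v"
      unfolding TV_eq_total_variation[OF v] total_variation_def using that by (intro SUP_upper) auto
    with real show ?thesis by (simp add: l2_inner_def)
  qed
  obtain \<psi> where \<psi>: "\<And>k. \<psi> k \<in> C1_compact_support {a<..<b}"
    "uniform_limit {a<..<b} \<psi> w sequentially"
    "(\<lambda>k. l2_norm {a<..<b} (\<lambda>x. deriv (\<psi> k) x - g x)) \<longlonglongrightarrow> 0"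
    using w by (auto simp: H10_def)
  have bound: "l2_inner {a<..<b} v g \<le> (1 + \<delta>) * T" if \<delta>: "0 < \<delta>" for \<delta>
  proof (rule tendsto_upperbound)
    show "(\<lambda>k. l2_inner {a<..<b} v (deriv (\<psi> k))) \<longlonglongrightarrow> l2_inner {a<..<b} v g"
      by (intro l2_tendsto_inner H10_L2[OF w] v \<psi>(3) always_eventually allI
          C1_compact_support_deriv_L2[OF \<psi>(1)])
    show "eventually (\<lambda>k. l2_inner {a<..<b} v (deriv (\<psi> k)) \<le> (1 + \<delta>) * T) sequentially"
      using uniform_limitD[OF \<psi>(2) \<delta>]
    proof eventually_elim
      case (elim k)
      have "\<bar>\<psi> k x\<bar> \<le> 1 + \<delta>" for x
      proof (cases "x \<in> {a<..<b}")
        case True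
        with elim have "\<bar>\<psi> k x - w x\<bar> < \<delta>" by (auto simp: dist_real_def)
        with le[OF True] show ?thesis by linarith
      qed (use C1_compact_support_eq_0[OF \<psi>(1)] \<delta> in simp)
      then have "\<bar>1 / (1 + \<delta>) * \<psi> k x\<bar> \<le> 1" for x
        using \<delta> by (simp add: abs_mult)
      from test[OF C1_compact_support_scale(1)[OF \<psi>(1)] this]
      show ?case using \<delta>
        by (simp add: C1_compact_support_scale(2)[OF \<psi>(1), of "1 / (1 + \<delta>)", simplified]
            l2_inner_scale_right[of _ _ "1 / (1 + \<delta>)", simplified] field_simps)
    qed
  qed simp
  have "l2_inner {a<..<b} v g \<le> T"
  proof (rule tendsto_lowerbound)
    show "((\<lambda>\<delta>. (1 + \<delta>) * T) \<longlongrightarrow> T) (at_right 0)"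
      by (auto intro!: tendsto_eq_intros)
    show "eventually (\<lambda>\<delta>. l2_inner {a<..<b} v g \<le> (1 + \<delta>) * T) (at_right 0)"
      using eventually_at_right_less[of "0::real"] by eventually_elim (rule bound)
  qed simp
  then show ?thesis using real by (simp add: l2_inner_commute)
qed simp

section \<open>Antiderivatives of mean-zero functions\<close>

text \<open>
  Truncation makes the dominated convergence argument of the next lemma possible.
\<close>

lemma L2_approx_bounded:
  assumes p: "p \<in> L2 I" and e: "0 < e"
  obtains B where "0 \<le> B" "l2_norm I (\<lambda>x. max (- B) (min B (p x)) - p x) < e"
proof -
  have "(\<lambda>n. l2_norm I (\<lambda>x. max (- real n) (min (real n) (p x)) - p x)) \<longlonglongrightarrow> 0"
  proof (rule l2_tendsto_dominated[where h = "\<lambda>x. \<bar>p x\<bar>"])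
    show "(\<lambda>x. max (- real k) (min (real k) (p x))) \<in> borel_measurable (lebesgue_on I)" for k
      using L2_borel[OF p] by simp
    show "p \<in> borel_measurable (lebesgue_on I)" using p by (rule L2_borel)
    show "(\<lambda>x. \<bar>p x\<bar>) \<in> L2 I"
      using L2_borel[OF p] L2_square[OF p] by (auto simp: L2_def intro!: borel_measurable_abs)
    show "AE x in lebesgue_on I. (\<lambda>k. max (- real k) (min (real k) (p x))) \<longlonglongrightarrow> p x"
    proof (intro AE_I2 tendsto_eventually)
      fix x
      obtain N :: nat where "\<bar>p x\<bar> \<le> real N" using real_arch_simple by blast
      then show "eventually (\<lambda>k. max (- real k) (min (real k) (p x)) = p x) sequentially"
        by (intro eventually_sequentiallyI[of N]) auto
    qed
    show "AE x in lebesgue_on I. \<bar>max (- real k) (min (real k) (p x)) - p x\<bar> \<le> \<bar>p x\<bar>" for k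
      by (intro AE_I2) auto
  qed
  from order_tendstoD(2)[OF this e] obtain n :: nat
    where "l2_norm I (\<lambda>x. max (- real n) (min (real n) (p x)) - p x) < e"
    using eventually_happens[of _ sequentially] by fastforce
  then show thesis by (intro that[of "real n"]) auto
qed

text \<open>
  A measurable function is an almost everywhere limit of continuous functions \<open>h n\<close>. Clipping them at height
  \<open>B\<close> and multiplying by cutoffs that exhaust the interval gives a sequence that is dominated by a constant and
  converges to \<open>p\<close> truncated at height \<open>B\<close>.
\<close>

lemma L2_approx_continuous:
  assumes p: "p \<in> L2 {a<..<b}" and e: "0 < e"
  obtains g c d where "continuous_on UNIV g" "a < c" "d < b" "\<And>x. x \<notin> {c..d} \<Longrightarrow> g x = 0"
    "l2_norm {a<..<b} (\<lambda>x. g x - p x) < e"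
proof -
  let ?U = "{a<..<b}"
  obtain B where B: "0 \<le> B" "l2_norm ?U (\<lambda>x. max (- B) (min B (p x)) - p x) < e / 2"
    using L2_approx_bounded[OF p, of "e / 2"] e by auto
  define q where "q x = max (- B) (min B (p x))" for x
  have qm: "q \<in> borel_measurable (lebesgue_on ?U)"
    unfolding q_def using L2_borel[OF p] by simp
  have "p measurable_on ?U"
    using L2_borel[OF p] by (simp add: measurable_on_iff_borel_measurable)
  then obtain N h where N: "negligible N" and h: "\<And>n. continuous_on UNIV (h n)"
    and lim: "\<And>x. x \<notin> N \<Longrightarrow> (\<lambda>n. h n x) \<longlonglongrightarrow> (if x \<in> ?U then p x else 0)"
    unfolding measurable_on_def by blast
  define cut where "cut n x = max 0 (min 1 (real (Suc n) * (x - a) - 1)) * max 0 (min 1 (real (Suc n) * (b - x) - 1))"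
    for n x
  define F where "F n x = cut n x * max (- B) (min B (h n x))" for n x
  have cont: "continuous_on UNIV (F n)" for n
    unfolding F_def cut_def by (intro continuous_intros h)
  have cut01: "0 \<le> cut n x" "cut n x \<le> 1" for n x
    unfolding cut_def by (auto intro!: mult_le_one)
  have supp: "F n x = 0" if "x \<notin> {a + 1 / Suc n..b - 1 / Suc n}" for n x
  proof -
    have "real (Suc n) * (x - a) - 1 \<le> 0 \<or> real (Suc n) * (b - x) - 1 \<le> 0"
      using that by (auto simp: field_simps)
    then show ?thesis by (auto simp: F_def cut_def)
  qed
  have "(\<lambda>n. l2_norm ?U (\<lambda>x. F n x - q x)) \<longlonglongrightarrow> 0"
  proof (rule l2_tendsto_dominated[where h = "\<lambda>x. 2 * B"])
    show "F n \<in> borel_measurable (lebesgue_on ?U)" for n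
      using L2_continuous[OF cont] by (rule L2_borel)
    show "q \<in> borel_measurable (lebesgue_on ?U)" by fact
    show "(\<lambda>x. 2 * B) \<in> L2 ?U" by (intro L2_continuous continuous_intros)
    show "AE x in lebesgue_on ?U. \<bar>F n x - q x\<bar> \<le> 2 * B" for n
    proof (rule AE_I2)
      fix x
      have "\<bar>F n x\<bar> \<le> 1 * B"
        unfolding F_def abs_mult using cut01[of n x] B by (intro mult_mono) auto
      moreover have "\<bar>q x\<bar> \<le> B" using B by (auto simp: q_def)
      ultimately show "\<bar>F n x - q x\<bar> \<le> 2 * B" by linarith
    qed
    have "AE x in lebesgue_on ?U. x \<notin> N"
    proof -
      have "AE x in lebesgue. x \<notin> N"
        using N by (intro AE_not_in) (simp add: negligible_iff_null_sets)
      then show ?thesis by (auto simp: AE_restrict_space_iff elim!: eventually_mono)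
    qed
    then show "AE x in lebesgue_on ?U. (\<lambda>n. F n x) \<longlonglongrightarrow> q x"
      using AE_space
    proof eventually_elim
      case (elim x)
      then have x: "x \<in> ?U" by simp
      obtain M1 :: nat where M1: "2 / (x - a) \<le> real M1" using real_arch_simple by blast
      obtain M2 :: nat where M2: "2 / (b - x) \<le> real M2" using real_arch_simple by blast
      have "cut n x = 1" if "max M1 M2 \<le> n" for n
      proof -
        have "2 / (x - a) \<le> real (Suc n)" "2 / (b - x) \<le> real (Suc n)" using M1 M2 that by auto
        then have "2 \<le> real (Suc n) * (x - a)" "2 \<le> real (Suc n) * (b - x)"
          using x by (simp_all add: divide_le_eq)
        then show ?thesis by (simp add: cut_def)
      qed
      then have "(\<lambda>n. cut n x) \<longlonglongrightarrow> 1"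
        by (intro tendsto_eventually eventually_sequentiallyI[of "max M1 M2"])
      moreover have "(\<lambda>n. h n x) \<longlonglongrightarrow> p x" using lim[OF elim(1)] x by simp
      ultimately have "(\<lambda>n. F n x) \<longlonglongrightarrow> 1 * max (- B) (min B (p x))"
        unfolding F_def by (intro tendsto_intros)
      then show ?case by (simp add: q_def)
    qed
  qed
  from order_tendstoD(2)[OF this, of "e / 2"] e obtain n :: nat
    where n: "l2_norm ?U (\<lambda>x. F n x - q x) < e / 2"
    using eventually_happens[of _ sequentially] by fastforce
  have q: "q \<in> L2 ?U"
  proof -
    have "\<bar>q x\<bar> \<le> B" for x using B by (auto simp: q_def)
    from L2_mult_bounded[OF L2_continuous[OF continuous_on_const[of _ 1]] qm this] show ?thesis by simp
  qed
  have "l2_norm ?U (\<lambda>x. F n x - p x) = l2_norm ?U (\<lambda>x. (F n x - q x) + (q x - p x))" by simp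
  also have "\<dots> \<le> l2_norm ?U (\<lambda>x. F n x - q x) + l2_norm ?U (\<lambda>x. q x - p x)"
    by (intro l2_norm_triangle L2_diff L2_continuous[OF cont] q p)
  also have "\<dots> < e" using n B by (simp add: q_def)
  finally show thesis
    by (intro that[OF cont _ _ supp]) auto
qed

lemma C1_compact_support_antiderivative:
  assumes g: "continuous_on UNIV g" and cd: "a < c" "d < b" and supp: "\<And>x. x \<notin> {c..d} \<Longrightarrow> g x = 0"
    and mean: "l2_inner {a<..<b} g (\<lambda>x. 1) = 0"
  obtains \<psi> where "\<psi> \<in> C1_compact_support {a<..<b}" "deriv \<psi> = g"
proof -
  define \<psi> where "\<psi> x = integral {a..x} g" for x
  have left: "\<psi> x = 0" if "x < c" for x
  proof -
    have "\<psi> x = integral {a..x} (\<lambda>x. 0)"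
      unfolding \<psi>_def using that supp by (intro integral_cong) auto
    then show ?thesis by simp
  qed
  have whole: "integral S g = integral UNIV g" if "{c..d} \<subseteq> S" for S
  proof -
    have "(if x \<in> S then g x else 0) = g x" for x
      using supp[of x] that by (cases "x \<in> {c..d}") auto
    with Henstock_Kurzweil_Integration.integral_restrict_UNIV[of S g] show ?thesis by simp
  qed
  have right: "\<psi> x = 0" if "d < x" for x
  proof -
    have "\<psi> x = integral UNIV g" unfolding \<psi>_def using that cd by (intro whole) auto
    also have "\<dots> = integral {a<..<b} g" using cd by (intro whole[symmetric]) auto
    also have "\<dots> = (LINT x|lebesgue_on {a<..<b}. g x)"
      by (intro lebesgue_integral_eq_integral[symmetric] L2_integrable L2_continuous g) simp
    also have "\<dots> = 0" using mean by (simp add: l2_inner_def)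
    finally show ?thesis .
  qed
  have D: "(\<psi> has_real_derivative g x) (at x)" for x
  proof (cases "x < c")
    case True
    have "((\<lambda>_. 0) has_real_derivative 0) (at x)" by (rule DERIV_const)
    then have "(\<psi> has_real_derivative 0) (at x)"
      by (rule has_field_derivative_transform_within_open[of _ _ _ "{..<c}"])
        (use True left in auto)
    then show ?thesis using supp True by simp
  next
    case False
    have "(\<psi> has_vector_derivative g x) (at x within {a..x + 1})"
      unfolding \<psi>_def using False cd
      by (intro integral_has_vector_derivative continuous_on_subset[OF g]) auto
    moreover have "at x within {a..x + 1} = at x"
      using False cd by (intro at_within_interior) auto
    ultimately show ?thesis by (simp add: has_real_derivative_iff_has_vector_derivative)
  qed
  have 0: "\<psi> x = 0" if "x \<notin> {c..d}" for x
    using left[of x] right[of x] that by auto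
  have "{c..d} \<subseteq> {a<..<b}" using cd by auto
  from C1_compact_supportI[OF D g compact_Icc this 0] show thesis by (rule that)
qed

text \<open>
  A continuous approximation \<open>g\<close> of \<open>p\<close> is the derivative of a test function once its mean vanishes.
  The mean is removed with a multiple of a fixed continuous \<open>\<theta>\<close> of compact support and
  nonzero mean; such a \<open>\<theta>\<close> is itself found by approximating the constant \<open>1\<close>. As \<open>p\<close> has mean zero, the
  multiple is controlled by the distance of \<open>g\<close> to \<open>p\<close>.
\<close>

lemma C1_compact_support_deriv_dense:
  assumes ab: "a < b" and p: "p \<in> L2 {a<..<b}" and mean: "l2_inner {a<..<b} p (\<lambda>x. 1) = 0" and e: "0 < e"
  obtains \<psi> where "\<psi> \<in> C1_compact_support {a<..<b}" "l2_norm {a<..<b} (\<lambda>x. deriv \<psi> x - p x) < e"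
proof -
  let ?U = "{a<..<b}"
  have one: "(\<lambda>x. 1) \<in> L2 ?U" by (intro L2_continuous continuous_on_const)
  define m where "m = l2_inner ?U (\<lambda>x. 1) (\<lambda>x. 1)"
  have m: "m = b - a" using ab by (simp add: m_def l2_inner_def measure_restrict_space)
  then have m0: "0 < m" using ab by simp
  have norm1: "l2_norm ?U (\<lambda>x. 1) = sqrt m" by (simp add: l2_norm_def m_def)
  obtain \<theta> c1 d1 where \<theta>: "continuous_on UNIV \<theta>" "a < c1" "d1 < b" "\<And>x. x \<notin> {c1..d1} \<Longrightarrow> \<theta> x = 0"
    and \<theta>1: "l2_norm ?U (\<lambda>x. \<theta> x - 1) < sqrt m"
    by (rule L2_approx_continuous[OF one real_sqrt_gt_zero[OF m0]]) (rule that)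
  have \<theta>L: "\<theta> \<in> L2 ?U" by (rule L2_continuous[OF \<theta>(1)])
  define s where "s = l2_inner ?U \<theta> (\<lambda>x. 1)"
  have "s \<noteq> 0"
  proof
    assume "s = 0"
    then have "m = - l2_inner ?U (\<lambda>x. \<theta> x - 1) (\<lambda>x. 1)"
      using \<theta>L one by (simp add: l2_inner_diff_left s_def m_def)
    also have "\<dots> \<le> l2_norm ?U (\<lambda>x. \<theta> x - 1) * l2_norm ?U (\<lambda>x. 1)"
      using l2_Cauchy_Schwarz[OF L2_diff[OF \<theta>L one] one] by linarith
    also have "\<dots> < sqrt m * sqrt m"
      unfolding norm1 using \<theta>1 m0 by (intro mult_strict_right_mono) auto
    finally show False using m0 by simp
  qed
  \<comment> \<open>Removing the mean enlarges the distance to \<open>p\<close> by at most this factor.\<close>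
  define C where "C = 1 + sqrt m / \<bar>s\<bar> * l2_norm ?U \<theta>"
  have C: "1 \<le> C" using m0 l2_norm_nonneg[of ?U \<theta>] by (simp add: C_def)
  have eC: "0 < e / C" using e C by simp
  obtain g c2 d2 where g: "continuous_on UNIV g" "a < c2" "d2 < b" "\<And>x. x \<notin> {c2..d2} \<Longrightarrow> g x = 0"
    and gp: "l2_norm ?U (\<lambda>x. g x - p x) < e / C"
    by (rule L2_approx_continuous[OF p eC]) (rule that)
  have gL: "g \<in> L2 ?U" by (rule L2_continuous[OF g(1)])
  define r where "r = l2_inner ?U g (\<lambda>x. 1) / s"
  have cont: "continuous_on UNIV (\<lambda>x. g x - r * \<theta> x)" by (intro continuous_intros g \<theta>)
  have supp: "g x - r * \<theta> x = 0" if "x \<notin> {min c1 c2..max d1 d2}" for x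
  proof -
    have "x \<notin> {c1..d1}" "x \<notin> {c2..d2}" using that by auto
    then show ?thesis using g(4) \<theta>(4) by simp
  qed
  have mean': "l2_inner ?U (\<lambda>x. g x - r * \<theta> x) (\<lambda>x. 1) = 0"
  proof -
    have "l2_inner ?U (\<lambda>x. g x - r * \<theta> x) (\<lambda>x. 1) = l2_inner ?U g (\<lambda>x. 1) - r * s"
      using gL \<theta>L one by (simp add: l2_inner_diff_left L2_scale l2_inner_scale_left s_def)
    then show ?thesis using \<open>s \<noteq> 0\<close> by (simp add: r_def)
  qed
  have ends: "a < min c1 c2" "max d1 d2 < b" using \<theta> g by auto
  obtain \<psi> where \<psi>: "\<psi> \<in> C1_compact_support ?U" "deriv \<psi> = (\<lambda>x. g x - r * \<theta> x)"
    using C1_compact_support_antiderivative[OF cont ends supp mean'] .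
  have "\<bar>l2_inner ?U g (\<lambda>x. 1)\<bar> \<le> l2_norm ?U (\<lambda>x. g x - p x) * sqrt m"
  proof -
    have "l2_inner ?U g (\<lambda>x. 1) = l2_inner ?U (\<lambda>x. g x - p x) (\<lambda>x. 1)"
      using gL p one mean by (simp add: l2_inner_diff_left)
    with l2_Cauchy_Schwarz[OF L2_diff[OF gL p] one] norm1 show ?thesis by simp
  qed
  then have "\<bar>r\<bar> \<le> l2_norm ?U (\<lambda>x. g x - p x) * sqrt m / \<bar>s\<bar>"
    by (simp add: r_def divide_right_mono)
  then have r: "\<bar>r\<bar> * l2_norm ?U \<theta> \<le> l2_norm ?U (\<lambda>x. g x - p x) * sqrt m / \<bar>s\<bar> * l2_norm ?U \<theta>"
    by (rule mult_right_mono) (rule l2_norm_nonneg)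
  have "l2_norm ?U (\<lambda>x. deriv \<psi> x - p x) = l2_norm ?U (\<lambda>x. (g x - p x) + (- r) * \<theta> x)"
    by (simp add: \<psi>(2) algebra_simps)
  also have "\<dots> \<le> l2_norm ?U (\<lambda>x. g x - p x) + l2_norm ?U (\<lambda>x. (- r) * \<theta> x)"
    by (intro l2_norm_triangle L2_diff L2_scale gL p \<theta>L)
  also have "\<dots> \<le> l2_norm ?U (\<lambda>x. g x - p x) * C"
    using r unfolding l2_norm_scale C_def by (simp add: algebra_simps)
  also have "\<dots> < e" using gp C by (simp add: field_simps)
  finally show thesis using \<psi>(1) by (rule that[rotated])
qed

lemma H10_antiderivative:
  assumes ab: "a < b" and p: "p \<in> L2 {a<..<b}" and mean: "l2_inner {a<..<b} p (\<lambda>x. 1) = 0"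
  shows "H10 a b (\<lambda>x. l2_inner {a<..<b} p (indicat_real {..<x})) p"
proof -
  let ?U = "{a<..<b}"
  have "\<exists>\<psi>. \<psi> \<in> C1_compact_support ?U \<and> l2_norm ?U (\<lambda>x. deriv \<psi> x - p x) < 1 / real (Suc k)" for k
    using C1_compact_support_deriv_dense[OF ab p mean, of "1 / real (Suc k)"] by auto
  then obtain \<psi> where \<psi>: "\<And>k. \<psi> k \<in> C1_compact_support ?U"
    and near: "\<And>k. l2_norm ?U (\<lambda>x. deriv (\<psi> k) x - p x) < 1 / real (Suc k)"
    by metis
  have lim: "(\<lambda>k. l2_norm ?U (\<lambda>x. deriv (\<psi> k) x - p x)) \<longlonglongrightarrow> 0"
  proof (rule Lim_null_comparison)
    show "eventually (\<lambda>k. norm (l2_norm ?U (\<lambda>x. deriv (\<psi> k) x - p x)) \<le> inverse (real (Suc k))) sequentially"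
      using near by (intro always_eventually allI) (simp add: l2_norm_nonneg less_imp_le inverse_eq_divide)
  qed (rule LIMSEQ_inverse_real_of_nat)
  have "uniform_limit ?U \<psi> (\<lambda>x. l2_inner ?U p (indicat_real {..<x})) sequentially"
  proof (rule uniform_limitI)
    fix e :: real assume e: "0 < e"
    have "(\<lambda>k. l2_norm ?U (\<lambda>x. deriv (\<psi> k) x - p x) * l2_norm ?U (\<lambda>x. 1)) \<longlonglongrightarrow> 0 * l2_norm ?U (\<lambda>x. 1)"
      by (intro tendsto_intros lim)
    then have "eventually (\<lambda>k. l2_norm ?U (\<lambda>x. deriv (\<psi> k) x - p x) * l2_norm ?U (\<lambda>x. 1) < e) sequentially"
      using e by (intro order_tendstoD(2)) auto
    then show "eventually (\<lambda>k. \<forall>x\<in>?U. dist (\<psi> k x) (l2_inner ?U p (indicat_real {..<x})) < e) sequentially"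
    proof eventually_elim
      case (elim k)
      show ?case
      proof
        fix x assume x: "x \<in> ?U"
        have d: "deriv (\<psi> k) \<in> L2 ?U" by (rule C1_compact_support_deriv_L2[OF \<psi>])
        have "dist (\<psi> k x) (l2_inner ?U p (indicat_real {..<x}))
            = \<bar>l2_inner ?U (\<lambda>x. deriv (\<psi> k) x - p x) (indicat_real {..<x})\<bar>"
          using C1_compact_support_FTC[OF \<psi>, of x k] x d p
          by (simp add: dist_real_def l2_inner_diff_left L2_indicator)
        also have "\<dots> \<le> l2_norm ?U (\<lambda>x. deriv (\<psi> k) x - p x) * l2_norm ?U (indicat_real {..<x})"
          by (intro l2_Cauchy_Schwarz L2_diff d p L2_indicator)
        also have "\<dots> \<le> l2_norm ?U (\<lambda>x. deriv (\<psi> k) x - p x) * l2_norm ?U (\<lambda>x. 1)"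
          by (intro mult_left_mono l2_norm_indicator_le l2_norm_nonneg)
        also have "\<dots> < e" by fact
        finally show "dist (\<psi> k x) (l2_inner ?U p (indicat_real {..<x})) < e" .
      qed
    qed
  qed
  with \<psi> lim p show ?thesis unfolding H10_def by blast
qed

section \<open>Minimal subgradients are eigenvectors\<close>

text \<open>
  A step function of height \<open>c\<close> that jumps at \<open>x\<close> inside the interval has variation at most \<open>|c|\<close>,
  and one that is constant on the interval has variation \<open>0\<close>; test with these for both signs of \<open>c\<close>.
\<close>

lemma potential_bounds:
  assumes p: "p \<in> L2 {a<..<b}" and le: "\<And>v. v \<in> L2 {a<..<b} \<Longrightarrow> ereal (l2_inner {a<..<b} p v) \<le> TV {a<..<b} v"
  shows "x \<in> {a<..<b} \<Longrightarrow> \<bar>l2_inner {a<..<b} p (indicat_real {..<x})\<bar> \<le> 1"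
    and "a < b \<Longrightarrow> l2_inner {a<..<b} p (\<lambda>x. 1) = 0"
proof -
  let ?U = "{a<..<b}"
  have step: "c * l2_inner ?U p (indicat_real {..<x}) \<le> B"
    if x: "a < x" "x \<le> b" and B: "\<And>\<phi>. \<phi> \<in> C1_compact_support ?U \<Longrightarrow> (\<And>x. \<bar>\<phi> x\<bar> \<le> 1) \<Longrightarrow> c * \<phi> x \<le> B"
    for x c B
  proof -
    have v: "(\<lambda>t. c * indicat_real {..<x} t) \<in> L2 ?U" by (intro L2_scale L2_indicator)
    have "ereal (l2_inner ?U p (\<lambda>t. c * indicat_real {..<x} t)) \<le> TV ?U (\<lambda>t. c * indicat_real {..<x} t)"
      by (rule le[OF v])
    also have "\<dots> \<le> ereal B"
      unfolding TV_eq_total_variation[OF v] total_variation_def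
    proof (rule SUP_least)
      fix \<phi> assume \<phi>: "\<phi> \<in> {\<phi> \<in> C1_compact_support ?U. \<forall>x. \<bar>\<phi> x\<bar> \<le> 1}"
      have "(LINT t|lebesgue_on ?U. c * indicat_real {..<x} t * deriv \<phi> t)
          = c * l2_inner ?U (deriv \<phi>) (indicat_real {..<x})"
        by (simp add: l2_inner_def mult.assoc mult.commute[of "indicat_real _ _"])
      also have "\<dots> = c * \<phi> x" using C1_compact_support_FTC[of \<phi> a b x] \<phi> x by simp
      finally show "ereal (LINT t|lebesgue_on ?U. c * indicat_real {..<x} t * deriv \<phi> t) \<le> ereal B"
        using B[of \<phi>] \<phi> by simp
    qed
    finally show ?thesis by (simp add: l2_inner_scale_right)
  qed
  show "\<bar>l2_inner ?U p (indicat_real {..<x})\<bar> \<le> 1" if x: "x \<in> ?U"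
  proof -
    have "1 * l2_inner ?U p (indicat_real {..<x}) \<le> 1"
      using x by (intro step) (auto simp: abs_le_iff)
    moreover have "- 1 * l2_inner ?U p (indicat_real {..<x}) \<le> 1"
      using x by (intro step) (auto simp: abs_le_iff minus_le_iff)
    ultimately show ?thesis by (simp add: abs_le_iff)
  qed
  show "l2_inner ?U p (\<lambda>x. 1) = 0" if "a < b"
  proof -
    have "c * l2_inner ?U p (indicat_real {..<b}) \<le> 0" for c
    proof (rule step[OF that])
      show "c * \<phi> b \<le> 0" if "\<phi> \<in> C1_compact_support ?U" for \<phi>
        using C1_compact_support_eq_0[OF that, of b] by simp
    qed simp
    from this[of 1] this[of "- 1"] have "l2_inner ?U p (indicat_real {..<b}) = 0" by simp
    moreover have "l2_inner ?U p (indicat_real {..<b}) = l2_inner ?U p (\<lambda>x. 1)"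
      unfolding l2_inner_def by (intro Bochner_Integration.integral_cong) auto
    ultimately show ?thesis by simp
  qed
qed

text \<open>
  By Bernoulli's inequality \<open>1 - z\<^sup>m \<le> m (1 - |z|)\<close>, so a perturbation with this factor does not
  exhaust the room \<open>1 - |z|\<close> left by the constraint.
\<close>

lemma cutoff_perturbation_le_1:
  fixes z c :: real
  assumes z: "\<bar>z\<bar> \<le> 1" and c: "\<bar>c\<bar> \<le> 1" and m: "0 < m" "even m" and s: "\<bar>s\<bar> \<le> 1 / real m"
  shows "\<bar>z + s * (c * (1 - z ^ m))\<bar> \<le> 1"
proof -
  have zm: "z ^ m = \<bar>z\<bar> ^ m" using m by (simp add: power_even_abs)
  have "1 + real m * (\<bar>z\<bar> - 1) \<le> (1 + (\<bar>z\<bar> - 1)) ^ m"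
    by (intro Bernoulli_inequality) simp
  then have "1 - z ^ m \<le> real m * (1 - \<bar>z\<bar>)" by (simp add: zm algebra_simps)
  moreover have "0 \<le> 1 - z ^ m" using z by (simp add: zm power_le_one)
  ultimately have "\<bar>s\<bar> * (\<bar>c\<bar> * \<bar>1 - z ^ m\<bar>) \<le> 1 / real m * (1 * (real m * (1 - \<bar>z\<bar>)))"
    using c s by (intro mult_mono) auto
  also have "\<dots> = 1 - \<bar>z\<bar>" using m by simp
  finally have "\<bar>s * (c * (1 - z ^ m))\<bar> \<le> 1 - \<bar>z\<bar>" by (simp add: abs_mult)
  then show ?thesis using abs_triangle_ineq[of z "s * (c * (1 - z ^ m))"] by linarith
qed

text \<open>
  Since both signs of \<open>s\<close> are allowed, every \<open>p + s g\<close> is again a subgradient at \<open>u\<close>: the inequality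
  \<open>\<langle>p + s g, u\<rangle> \<le> J(u) = \<langle>p, u\<rangle>\<close> forces \<open>\<langle>g, u\<rangle> = 0\<close>. Minimality of \<open>p\<close> along this segment
  makes its derivative at \<open>s = 0\<close> vanish.
\<close>

lemma subdiff_minimal_Euler_Lagrange:
  assumes p: "p \<in> subdiff {a<..<b} (TV {a<..<b}) u" and u: "u \<in> L2 {a<..<b}"
    and minimal: "\<And>q. q \<in> subdiff {a<..<b} (TV {a<..<b}) u \<Longrightarrow> l2_inner {a<..<b} p p \<le> l2_inner {a<..<b} q p"
    and Z: "H10 a b Z p" and \<psi>: "H10 a b \<psi> g" and \<epsilon>: "0 < \<epsilon>"
    and le: "\<And>x s. x \<in> {a<..<b} \<Longrightarrow> \<bar>s\<bar> \<le> \<epsilon> \<Longrightarrow> \<bar>Z x + s * \<psi> x\<bar> \<le> 1"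
  shows "l2_inner {a<..<b} g p = 0"
proof -
  let ?U = "{a<..<b}"
  have pL: "p \<in> L2 ?U" and gL: "g \<in> L2 ?U" using Z \<psi> by (auto dest: H10_L2)
  have qL: "(\<lambda>x. p x + s * g x) \<in> L2 ?U" for s by (intro L2_add L2_scale pL gL)
  have dual: "ereal (l2_inner ?U (\<lambda>x. p x + s * g x) v) \<le> TV ?U v" if "\<bar>s\<bar> \<le> \<epsilon>" "v \<in> L2 ?U" for s v
    using that by (intro H10_deriv_le_TV[of a b "\<lambda>x. Z x + s * \<psi> x"] H10_add H10_scale Z \<psi> le)
  have "s * l2_inner ?U g u \<le> 0" if "\<bar>s\<bar> \<le> \<epsilon>" for s
    using dual[OF that u] pL gL u
    by (simp add: subdiff_eq[OF p] l2_inner_add_left L2_scale l2_inner_scale_left)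
  from this[of \<epsilon>] this[of "- \<epsilon>"] \<epsilon> have gu: "l2_inner ?U g u = 0"
    by (auto simp: mult_le_0_iff zero_le_mult_iff)
  have "0 \<le> s * l2_inner ?U g p" if s: "\<bar>s\<bar> \<le> \<epsilon>" for s
  proof -
    have "(\<lambda>x. p x + s * g x) \<in> subdiff ?U (TV ?U) u"
      using dual[OF s] qL pL gL u gu
      by (simp add: subdiff_def subdiff_eq[OF p] l2_inner_add_left L2_scale l2_inner_scale_left)
    from minimal[OF this] pL gL show ?thesis
      by (simp add: l2_inner_add_left L2_scale l2_inner_scale_left)
  qed
  from this[of \<epsilon>] this[of "- \<epsilon>"] \<epsilon> show ?thesis
    by (auto simp: mult_le_0_iff zero_le_mult_iff)
qed

text \<open>
  \<open>E k\<close> abbreviates \<open>\<integral> Z\<^sup>k p\<^sup>2\<close>. Its decay for even \<open>k\<close> says that \<open>p\<close> vanishes almost everywhere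
  on the contact set \<open>{|Z| = 1}\<close>.
\<close>

lemma subdiff_minimal_imp_eigenvector:
  assumes p: "p \<in> subdiff {a<..<b} (TV {a<..<b}) u" and u: "u \<in> L2 {a<..<b}"
    and minimal: "\<And>q. q \<in> subdiff {a<..<b} (TV {a<..<b}) u \<Longrightarrow> l2_inner {a<..<b} p p \<le> l2_inner {a<..<b} q p"
  shows "p \<in> subdiff {a<..<b} (TV {a<..<b}) p"
proof -
  let ?U = "{a<..<b}"
  have pL: "p \<in> L2 ?U" using p by (rule subdiff_L2)
  have test: "l2_inner ?U p (deriv \<phi>) \<le> l2_inner ?U p p"
    if \<phi>: "\<phi> \<in> C1_compact_support ?U" and \<phi>1: "\<And>x. \<bar>\<phi> x\<bar> \<le> 1" for \<phi>
  proof (cases "a < b")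
    case False
    then have "?U = {}" by simp
    then show ?thesis by (simp add: l2_inner_def)
  next
    case ab: True
    define Z where "Z x = l2_inner ?U p (indicat_real {..<x})" for x
    have Z: "H10 a b Z p"
      unfolding Z_def using ab pL
      by (intro H10_antiderivative potential_bounds(2)[OF pL subdiff_le[OF p]])
    have Z1: "\<bar>Z x\<bar> \<le> 1" if "x \<in> ?U" for x
      unfolding Z_def by (rule potential_bounds(1)[OF pL subdiff_le[OF p] that])
    have \<phi>H: "H10 a b \<phi> (deriv \<phi>)" using \<phi> by (rule H10_C1_compact_support)
    have dL: "deriv \<phi> \<in> L2 ?U" using \<phi>H by (rule H10_L2)
    note Zm = H10_borel[OF Z] and \<phi>m = H10_borel[OF \<phi>H]
    have pow_le: "\<bar>Z x ^ k\<bar> \<le> 1" if "x \<in> ?U" for x k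
      using Z1[OF that] by (simp add: power_abs power_le_one)
    have pZL: "(\<lambda>x. p x * Z x ^ k) \<in> L2 ?U" for k
      using Zm by (intro L2_mult_bounded[where B = 1] pL pow_le) auto
    define N where "N = l2_inner ?U p p"
    define E where "E k = l2_inner ?U p (\<lambda>x. p x * Z x ^ k)" for k
    \<comment> \<open>The Euler-Lagrange equation for the perturbation \<open>\<eta> (1 - Z\<^sup>m)\<close>.\<close>
    have EL: "l2_inner ?U p g = l2_inner ?U g (\<lambda>x. p x * Z x ^ m)
        + real m * l2_inner ?U p (\<lambda>x. p x * (Z x ^ (m - 1) * \<eta> x))"
      if \<eta>: "H10 a b \<eta> g" and \<eta>1: "\<And>x. x \<in> ?U \<Longrightarrow> \<bar>\<eta> x\<bar> \<le> 1" and m: "0 < m" "even m" for \<eta> g m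
    proof -
      have gL: "g \<in> L2 ?U" using \<eta> by (rule H10_L2)
      have gZ: "(\<lambda>x. g x * Z x ^ m) \<in> L2 ?U"
        using Zm by (intro L2_mult_bounded[where B = 1] gL pow_le) auto
      have pZ\<eta>: "(\<lambda>x. p x * (Z x ^ (m - 1) * \<eta> x)) \<in> L2 ?U"
      proof (rule L2_mult_bounded[where B = 1, OF pL])
        show "(\<lambda>x. Z x ^ (m - 1) * \<eta> x) \<in> borel_measurable (lebesgue_on ?U)"
          using Zm H10_borel[OF \<eta>] by simp
        show "\<bar>Z x ^ (m - 1) * \<eta> x\<bar> \<le> 1" if "x \<in> ?U" for x
          unfolding abs_mult using pow_le[OF that, of "m - 1"] \<eta>1[OF that] by (intro mult_le_one) auto
      qed
      have Suc_m: "Suc (m - 1) = m" using m by simp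
      have "H10 a b (\<lambda>x. \<eta> x + (- 1) * (\<eta> x * Z x ^ m))
          (\<lambda>x. g x + (- 1) * (g x * Z x ^ m + p x * (real m * Z x ^ (m - 1)) * \<eta> x))"
        using H10_add[OF \<eta> H10_scale[OF H10_mult[OF \<eta> H10_power[OF Z, of "m - 1"]], of "- 1"]]
        unfolding Suc_m .
      also have "(\<lambda>x. \<eta> x + (- 1) * (\<eta> x * Z x ^ m)) = (\<lambda>x. \<eta> x * (1 - Z x ^ m))"
        by (simp add: algebra_simps)
      also have "(\<lambda>x. g x + (- 1) * (g x * Z x ^ m + p x * (real m * Z x ^ (m - 1)) * \<eta> x))
          = (\<lambda>x. g x - (g x * Z x ^ m + real m * (p x * (Z x ^ (m - 1) * \<eta> x))))"
        by (simp add: algebra_simps)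
      finally have \<psi>: "H10 a b (\<lambda>x. \<eta> x * (1 - Z x ^ m))
          (\<lambda>x. g x - (g x * Z x ^ m + real m * (p x * (Z x ^ (m - 1) * \<eta> x))))" .
      have "l2_inner ?U (\<lambda>x. g x - (g x * Z x ^ m + real m * (p x * (Z x ^ (m - 1) * \<eta> x)))) p = 0"
        using m by (intro subdiff_minimal_Euler_Lagrange[OF p u minimal Z \<psi>, of "1 / real m"]
            cutoff_perturbation_le_1 Z1 \<eta>1) auto
      then have "l2_inner ?U g p - (l2_inner ?U (\<lambda>x. g x * Z x ^ m) p
          + real m * l2_inner ?U (\<lambda>x. p x * (Z x ^ (m - 1) * \<eta> x)) p) = 0"
        using gL gZ pZ\<eta> pL
        by (simp add: l2_inner_diff_left l2_inner_add_left L2_add L2_scale l2_inner_scale_left)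
      moreover have "l2_inner ?U (\<lambda>x. g x * Z x ^ m) p = l2_inner ?U g (\<lambda>x. p x * Z x ^ m)"
        by (simp add: l2_inner_def mult_ac)
      ultimately show ?thesis by (simp add: l2_inner_commute[of _ _ p])
    qed
    \<comment> \<open>The choice \<open>\<eta> = Z\<close>, which is bounded by \<open>1\<close> and has derivative \<open>p\<close>.\<close>
    have E: "E m = N / (real m + 1)" if "even m" for m
    proof (cases "m = 0")
      case True
      then show ?thesis by (simp add: E_def N_def)
    next
      case False
      then have m: "0 < m" by simp
      have "Z x ^ (m - 1) * Z x = Z x ^ m" for x using m by (metis power_minus_mult)
      with EL[OF Z Z1 m that] have "N = E m + real m * E m" by (simp add: N_def E_def)
      then show ?thesis by (simp add: field_simps)
    qed
    \<comment> \<open>The choice \<open>\<eta> = \<phi>\<close>; the term with \<open>\<phi>'\<close> is small since \<open>\<parallel>p Z\<^sup>m\<parallel>\<^sup>2 = E (2 m)\<close>.\<close>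
    have bound: "l2_inner ?U p (deriv \<phi>) \<le> l2_norm ?U (deriv \<phi>) * sqrt (N / (2 * real m + 1))
        + real m / (real m - 1) * N" if m: "even m" "2 \<le> m" for m
    proof -
      have "l2_inner ?U (deriv \<phi>) (\<lambda>x. p x * Z x ^ m)
          \<le> l2_norm ?U (deriv \<phi>) * l2_norm ?U (\<lambda>x. p x * Z x ^ m)"
        using l2_Cauchy_Schwarz[OF dL pZL] abs_le_D1 by blast
      also have "l2_norm ?U (\<lambda>x. p x * Z x ^ m) = sqrt (E (2 * m))"
        by (simp add: l2_norm_def E_def l2_inner_def mult_2 power_add) (simp add: mult_ac)
      finally have 1: "l2_inner ?U (deriv \<phi>) (\<lambda>x. p x * Z x ^ m)
          \<le> l2_norm ?U (deriv \<phi>) * sqrt (N / (2 * real m + 1))"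
        using E[of "2 * m"] by simp
      \<comment> \<open>The exponent \<open>m - 1\<close> is odd; one factor \<open>Z\<close> is spent together with \<open>\<phi>\<close> to reach an even one.\<close>
      have "l2_inner ?U p (\<lambda>x. p x * (Z x ^ (m - 1) * \<phi> x)) \<le> E (m - 2)"
        unfolding E_def l2_inner_def
      proof (rule integral_mono)
        have "(\<lambda>x. p x * (Z x ^ (m - 1) * \<phi> x)) \<in> L2 ?U"
        proof (rule L2_mult_bounded[where B = 1, OF pL])
          show "(\<lambda>x. Z x ^ (m - 1) * \<phi> x) \<in> borel_measurable (lebesgue_on ?U)"
            using Zm \<phi>m by simp
          show "\<bar>Z x ^ (m - 1) * \<phi> x\<bar> \<le> 1" if "x \<in> ?U" for x
            unfolding abs_mult using pow_le[OF that, of "m - 1"] \<phi>1 by (intro mult_le_one) auto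
        qed
        then show "integrable (lebesgue_on ?U) (\<lambda>x. p x * (p x * (Z x ^ (m - 1) * \<phi> x)))"
          by (rule L2_mult_integrable[OF pL])
        show "integrable (lebesgue_on ?U) (\<lambda>x. p x * (p x * Z x ^ (m - 2)))"
          by (rule L2_mult_integrable[OF pL pZL])
        fix x assume "x \<in> space (lebesgue_on ?U)"
        then have x: "x \<in> ?U" by simp
        have ev: "even (m - 2)" using m by simp
        have "Z x ^ (m - 1) * \<phi> x = Z x ^ (m - 2) * (Z x * \<phi> x)"
          using m by (simp add: power_Suc2[symmetric] Suc_diff_Suc numeral_2_eq_2 flip: mult.assoc)
        also have "\<dots> \<le> Z x ^ (m - 2) * 1"
        proof (rule mult_left_mono)
          have "\<bar>Z x * \<phi> x\<bar> \<le> 1" unfolding abs_mult using Z1[OF x] \<phi>1[of x] by (intro mult_le_one) auto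
          then show "Z x * \<phi> x \<le> 1" by linarith
          show "0 \<le> Z x ^ (m - 2)" using ev by (simp add: zero_le_even_power)
        qed
        finally have "(p x * p x) * (Z x ^ (m - 1) * \<phi> x) \<le> (p x * p x) * Z x ^ (m - 2)"
          by (intro mult_left_mono) auto
        then show "p x * (p x * (Z x ^ (m - 1) * \<phi> x)) \<le> p x * (p x * Z x ^ (m - 2))"
          by (simp add: mult.assoc)
      qed
      also have "E (m - 2) = N / (real m - 1)"
        using E[of "m - 2"] m by (simp add: of_nat_diff)
      finally have "real m * l2_inner ?U p (\<lambda>x. p x * (Z x ^ (m - 1) * \<phi> x)) \<le> real m * (N / (real m - 1))"
        by (intro mult_left_mono) auto
      with 1 EL[OF \<phi>H \<phi>1, of m] m show ?thesis by simp
    qed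
    have lim: "(\<lambda>n. l2_norm ?U (deriv \<phi>) * sqrt (N / (2 * real (2 * n) + 1)) + real (2 * n) / (real (2 * n) - 1) * N)
        \<longlonglongrightarrow> l2_norm ?U (deriv \<phi>) * sqrt 0 + 1 * N"
    proof (intro tendsto_intros)
      show "(\<lambda>n. N / (2 * real (2 * n) + 1)) \<longlonglongrightarrow> 0" by real_asymp
      show "(\<lambda>n. real (2 * n) / (real (2 * n) - 1)) \<longlonglongrightarrow> 1" by real_asymp
    qed
    have "eventually (\<lambda>n. l2_inner ?U p (deriv \<phi>)
        \<le> l2_norm ?U (deriv \<phi>) * sqrt (N / (2 * real (2 * n) + 1)) + real (2 * n) / (real (2 * n) - 1) * N) sequentially"
      by (intro eventually_sequentiallyI[of 1] bound) auto
    from tendsto_lowerbound[OF lim this] show ?thesis by (simp add: N_def)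
  qed
  have "TV ?U p \<le> ereal (l2_inner ?U p p)"
    unfolding TV_eq_total_variation[OF pL] total_variation_def
    using test by (intro SUP_least) (auto simp: l2_inner_def)
  then have "ereal (l2_inner ?U p p) = TV ?U p"
    using subdiff_le[OF p pL] by (rule antisym[rotated])
  then show ?thesis using p by (simp add: subdiff_def)
qed

section \<open>Reduction to open intervals\<close>

lemma lebesgue_on_negligible_difference:
  fixes f :: "real \<Rightarrow> real"
  assumes S: "S \<in> sets lebesgue" and T: "T \<in> sets lebesgue" and TS: "T \<subseteq> S" and neg: "negligible (S - T)"
  shows "f \<in> borel_measurable (lebesgue_on S) \<longleftrightarrow> f \<in> borel_measurable (lebesgue_on T)"
    and "integrable (lebesgue_on S) f \<longleftrightarrow> integrable (lebesgue_on T) f"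
    and "integral\<^sup>L (lebesgue_on S) f = integral\<^sup>L (lebesgue_on T) f"
proof -
  let ?F = "\<lambda>A x. if x \<in> A then f x else 0"
  have "AE x in lebesgue. x \<notin> S - T"
    using neg by (intro AE_not_in) (simp add: negligible_iff_null_sets)
  then have ae: "AE x in lebesgue. ?F S x = ?F T x"
    by eventually_elim (use TS in auto)
  then have ae': "AE x in lebesgue. ?F T x = ?F S x"
    by eventually_elim simp
  have meas: "?F S \<in> borel_measurable lebesgue \<longleftrightarrow> ?F T \<in> borel_measurable lebesgue"
    using borel_measurable_AE[OF _ ae] borel_measurable_AE[OF _ ae'] by blast
  show "f \<in> borel_measurable (lebesgue_on S) \<longleftrightarrow> f \<in> borel_measurable (lebesgue_on T)"
    using meas borel_measurable_if[OF S, of f] borel_measurable_if[OF T, of f] by simp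
  have "integrable lebesgue (?F S) \<longleftrightarrow> integrable lebesgue (?F T)"
    using meas integrable_cong_AE[OF _ _ ae] by (meson borel_measurable_integrable)
  then show int: "integrable (lebesgue_on S) f \<longleftrightarrow> integrable (lebesgue_on T) f"
    using Lebesgue_Measure.integrable_restrict_UNIV[OF S, of f]
      Lebesgue_Measure.integrable_restrict_UNIV[OF T, of f] by simp
  show "integral\<^sup>L (lebesgue_on S) f = integral\<^sup>L (lebesgue_on T) f"
  proof (cases "integrable (lebesgue_on S) f")
    case True
    then have "integrable lebesgue (?F S)" "integrable lebesgue (?F T)"
      using int Lebesgue_Measure.integrable_restrict_UNIV[OF S, of f]
        Lebesgue_Measure.integrable_restrict_UNIV[OF T, of f] by simp_all
    then have "integral\<^sup>L lebesgue (?F S) = integral\<^sup>L lebesgue (?F T)"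
      by (intro integral_cong_AE ae) auto
    then show ?thesis
      using Lebesgue_Measure.integral_restrict_UNIV[OF S, of f]
        Lebesgue_Measure.integral_restrict_UNIV[OF T, of f] by simp
  qed (use int in \<open>simp add: not_integrable_integral_eq\<close>)
qed

lemma open_bounded_interval_cases:
  fixes S :: "real set"
  assumes S: "is_interval S" "open S" "bounded S"
  obtains a b where "S = {a<..<b}"
proof (cases "S = {}")
  case True
  then show thesis by (intro that[of 0 0]) simp
next
  case False
  have bdd: "bdd_below S" "bdd_above S"
    using \<open>bounded S\<close> by (auto intro: bounded_imp_bdd_below bounded_imp_bdd_above)
  have "S = {Inf S<..<Sup S}"
  proof
    show "S \<subseteq> {Inf S<..<Sup S}"
    proof
      fix x assume x: "x \<in> S"
      then obtain e where e: "0 < e" "ball x e \<subseteq> S" using \<open>open S\<close> openE by blast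
      have "x - e / 2 \<in> S" "x + e / 2 \<in> S" using e by (auto intro!: subsetD[OF e(2)] simp: dist_real_def)
      then have "Inf S \<le> x - e / 2" "x + e / 2 \<le> Sup S"
        using bdd by (auto intro: cInf_lower cSup_upper)
      with e(1) show "x \<in> {Inf S<..<Sup S}" by auto
    qed
    show "{Inf S<..<Sup S} \<subseteq> S"
    proof
      fix x assume x: "x \<in> {Inf S<..<Sup S}"
      then obtain y z where "y \<in> S" "y < x" "z \<in> S" "x < z"
        using cInf_lessD[OF False] less_cSupD[OF False] by (metis greaterThanLessThan_iff)
      then show "x \<in> S" using S(1) by (meson is_interval_1 less_imp_le)
    qed
  qed
  then show thesis by (rule that)
qed

text \<open>
  The variation lives on the interior of \<open>I\<close> but the inner product on \<open>I\<close>; as the end points form a null set,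
  both may be taken on the open interval.
\<close>

lemma bounded_interval_L2_interior:
  assumes "is_interval I" and "bounded I"
  obtains a b where "interior I = {a<..<b}" "L2 I = L2 {a<..<b}" "l2_inner I = l2_inner {a<..<b}"
proof -
  have I: "convex I" using assms by (simp add: is_interval_convex)
  have neg: "negligible (I - interior I)"
    using closure_subset[of I]
    by (intro negligible_subset[OF negligible_convex_frontier[OF I]]) (auto simp: frontier_def)
  have "is_interval (interior I)" using convex_interior[OF I] by (simp add: is_interval_convex_1)
  then obtain a b where ab: "interior I = {a<..<b}"
    using bounded_subset[OF assms(2) interior_subset] by (auto elim: open_bounded_interval_cases)
  have Im: "I \<in> sets lebesgue"
    using measurable_convex[OF I assms(2)] by (rule fmeasurableD)
  have "{a<..<b} \<subseteq> I" using interior_subset[of I] by (simp add: ab)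
  note * = lebesgue_on_negligible_difference[OF Im _ this neg[unfolded ab]]
  have "L2 I = L2 {a<..<b}"
    unfolding L2_def by (simp add: *(1,2))
  moreover have "l2_inner I = l2_inner {a<..<b}"
    unfolding l2_inner_def by (intro ext *(3)) simp
  ultimately show thesis using ab by (intro that)
qed

theorem theorem5p10:
  fixes I :: "real set" and f :: "real \<Rightarrow> real" and u p :: "real \<Rightarrow> real \<Rightarrow> real"
  assumes "is_interval I" and "bounded I"
    and "f \<in> l2_closure I (dom_subdiff I (TV I))"
    and "gradient_flow I (TV I) f u p"
  shows "\<forall>t>0. p t \<in> subdiff I (TV I) (p t)"
proof (intro allI impI)
  fix t :: real assume t: "0 < t"
  obtain a b where ab: "interior I = {a<..<b}" "L2 I = L2 {a<..<b}" "l2_inner I = l2_inner {a<..<b}"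
    using bounded_interval_L2_interior[OF assms(1,2)] .
  have TV: "TV I = TV {a<..<b}"
    by (simp add: TV_def ab interior_open fun_eq_iff)
  have subdiff: "subdiff I (TV I) v = subdiff {a<..<b} (TV {a<..<b}) v" for v
    by (simp add: subdiff_def ab TV)
  have u: "u t \<in> L2 I" and p: "p t \<in> subdiff I (TV I) (u t)"
    using assms(4) t by (auto simp: gradient_flow_def)
  show "p t \<in> subdiff I (TV I) (p t)"
    using subdiff_minimal_imp_eigenvector[OF p[unfolded subdiff] u[unfolded ab]]
      gradient_flow_variational[OF assms(4) t]
    unfolding subdiff ab by blast
qed

end
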